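(* Let $\ell \geqslant 1$ be an integer, and let $G$ be a graph of girth at least $\ell + 1$ such that the $\ell$-path graph $\mathbb{P}_\ell(G)$ contains at least one edge. Then $\eta(\mathbb{P}_\ell(G)) \geqslant \max\{\eta(G), \mathrm{d}(G)\}$, where $\eta$ denotes the Hadwiger number and $\mathrm{d}(G)$ the degeneracy of $G$.
   Context: All graphs are finite, undirected and loopless; parallel edges are allowed. For an integer $\ell \geqslant 0$, an $\ell$-arc of $G$ is an alternating sequence $\vec{L} = (v_0, e_1, v_1, \ldots, e_\ell, v_\ell)$ of vertices and edges of $G$ such that $e_i$ has end vertices $v_{i-1}, v_i$ for $1 \leqslant i \leqslant \ell$, and $e_i \neq e_{i+1}$ for $1 \leqslant i \leqslant \ell - 1$. An $\ell$-link is an $\ell$-arc identified with its reverse sequence. For an $\ell$-arc $\vec{L}$ and $0 \leqslant i \leqslant j \leqslant \ell$, $\vec{L}[i,j]$ is the $(j-i)$-link $[v_i, e_{i+1}, \ldots, e_j, v_j]$. An $\ell$-path is an $\ell$-link without repeated vertices. An $\ell$-cycle ($\ell \geqslant 2$) is an $\ell$-link $[v_0, e_1, \ldots, e_\ell, v_\ell]$ with $v_0 = v_\ell$ such that $[v_0, e_1, \ldots, e_{\ell-1}, v_{\ell-1}]$ is an $(\ell-1)$-path. The $\ell$-path graph $\mathbb{P}_\ell(G)$ is the simple graph whose vertices are the $\ell$-paths of $G$, in which two distinct $\ell$-paths $L, R$ are adjacent if and only if there is an $(\ell+1)$-link $Q$ of $G$ that is an $(\ell+1)$-path or an $(\ell+1)$-cycle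 with $\{\vec{Q}[0,\ell], \vec{Q}[1,\ell+1]\} = \{L, R\}$. The girth of $G$ is the minimum length of a cycle in $G$, where two parallel edges form a cycle of length $2$ (girth is $\infty$ if $G$ is acyclic). Contracting an edge means identifying its end vertices and deleting resulting loops; $H$ is a minor of $G$ if $H$ can be obtained from a subgraph of $G$ by contracting edges. The Hadwiger number $\eta(G)$ is the maximum integer $t$ such that $G$ has a minor isomorphic to $K_t$. The degeneracy $\mathrm{d}(G)$ is the maximum, over subgraphs $H$ of $G$, of the minimum degree $\delta(H)$ (degrees count parallel edges with multiplicity). *)

theory Defs
  imports Main "HOL-Library.Extended_Nat"
begin

section \<open>Finite loopless multigraphs\<close>

text \<open>Edges are objects of their own, so that parallel edges (distinct edges with the same two ends)
  are possible. The value of \<open>ends\<close> outside the edge set is irrelevant.\<close>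

record ('v, 'e) mgraph =
  verts :: "'v set"
  edges :: "'e set"
  ends :: "'e \<Rightarrow> 'v set"

definition graph :: "('v, 'e) mgraph \<Rightarrow> bool" where
  "graph G \<longleftrightarrow> finite (verts G) \<and> finite (edges G) \<and>
     (\<forall>e \<in> edges G. ends G e \<subseteq> verts G \<and> card (ends G e) = 2)"

definition subgraph :: "('v, 'e) mgraph \<Rightarrow> ('v, 'e) mgraph \<Rightarrow> bool" where
  "subgraph H G \<longleftrightarrow> graph H \<and> verts H \<subseteq> verts G \<and> edges H \<subseteq> edges G \<and>
     (\<forall>e \<in> edges H. ends H e = ends G e)"

definition isomorphic :: "('v, 'e) mgraph \<Rightarrow> ('w, 'f) mgraph \<Rightarrow> bool" where
  "isomorphic G H \<longleftrightarrow> (\<exists>\<phi> \<psi>. bij_betw \<phi> (verts G) (verts H) \<and> bij_betw \<psi> (edges G) (edges H) \<and>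
     (\<forall>e \<in> edges G. ends H (\<psi> e) = \<phi> ` ends G e))"

definition complete_graph :: "nat \<Rightarrow> (nat, nat set) mgraph" where
  "complete_graph t = \<lparr>verts = {..<t}, edges = {e. e \<subseteq> {..<t} \<and> card e = 2}, ends = (\<lambda>e. e)\<rparr>"


section \<open>Degeneracy\<close>

definition degree :: "('v, 'e) mgraph \<Rightarrow> 'v \<Rightarrow> nat" where
  "degree G v = card {e \<in> edges G. v \<in> ends G e}"

definition min_degree :: "('v, 'e) mgraph \<Rightarrow> nat" where
  "min_degree G = Min (degree G ` verts G)"

text \<open>The minimum degree only makes sense for graphs with a vertex, so the maximum is over the
  nonempty subgraphs; consequently \<open>degeneracy\<close> is meaningful only for nonempty graphs.\<close>

definition degeneracy :: "('v, 'e) mgraph \<Rightarrow> nat" where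
  "degeneracy G = Max {min_degree H | H. subgraph H G \<and> verts H \<noteq> {}}"


section \<open>Minors and the Hadwiger number\<close>

text \<open>Contracting an edge with ends \<open>u\<close> and \<open>v\<close>: the merged vertex is called \<open>u\<close>. The loops that
  arise come from that edge and from the edges parallel to it; all other parallel edges are kept.\<close>

definition contract :: "('v, 'e) mgraph \<Rightarrow> 'v \<Rightarrow> 'v \<Rightarrow> ('v, 'e) mgraph" where
  "contract G u v = \<lparr>verts = verts G - {v}, edges = {f \<in> edges G. ends G f \<noteq> {u, v}},
     ends = (\<lambda>f. (\<lambda>x. if x = v then u else x) ` ends G f)\<rparr>"

definition contracts_edge :: "('v, 'e) mgraph \<Rightarrow> ('v, 'e) mgraph \<Rightarrow> bool" where
  "contracts_edge G H \<longleftrightarrow> (\<exists>e \<in> edges G. \<exists>u v. ends G e = {u, v} \<and> H = contract G u v)"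

definition has_minor :: "('v, 'e) mgraph \<Rightarrow> ('w, 'f) mgraph \<Rightarrow> bool" where
  "has_minor G H \<longleftrightarrow> (\<exists>S M. subgraph S G \<and> contracts_edge\<^sup>*\<^sup>* S M \<and> isomorphic M H)"

definition hadwiger :: "('v, 'e) mgraph \<Rightarrow> nat" where
  "hadwiger G = Max {t. has_minor G (complete_graph t)}"


section \<open>Arcs, links, paths and cycles\<close>

text \<open>The sequence \<open>(v\<^sub>0, e\<^sub>1, v\<^sub>1, \<dots>, e\<^sub>l, v\<^sub>l)\<close> is stored as its list of vertices and its list of
  edges; thus \<open>e\<^sub>i\<close> is element \<open>i - 1\<close> of the latter. A link is the set
  consisting of an arc and its reverse.\<close>

type_synonym ('v, 'e) arc = "'v list \<times> 'e list"
type_synonym ('v, 'e) link = "('v, 'e) arc set"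

definition is_arc :: "('v, 'e) mgraph \<Rightarrow> nat \<Rightarrow> ('v, 'e) arc \<Rightarrow> bool" where
  "is_arc G l A \<longleftrightarrow> (case A of (vs, es) \<Rightarrow>
     length vs = Suc l \<and> length es = l \<and> set vs \<subseteq> verts G \<and> set es \<subseteq> edges G \<and>
     (\<forall>i<l. ends G (es ! i) = {vs ! i, vs ! Suc i}) \<and>
     (\<forall>i. Suc i < l \<longrightarrow> es ! i \<noteq> es ! Suc i))"

definition link_of :: "('v, 'e) arc \<Rightarrow> ('v, 'e) link" where
  "link_of A = {A, (rev (fst A), rev (snd A))}"

definition sublink :: "('v, 'e) arc \<Rightarrow> nat \<Rightarrow> nat \<Rightarrow> ('v, 'e) link" where
  "sublink A i j = link_of (take (Suc (j - i)) (drop i (fst A)), take (j - i) (drop i (snd A)))"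

definition paths :: "('v, 'e) mgraph \<Rightarrow> nat \<Rightarrow> ('v, 'e) link set" where
  "paths G l = {link_of A | A. is_arc G l A \<and> distinct (fst A)}"

definition cycles :: "('v, 'e) mgraph \<Rightarrow> nat \<Rightarrow> ('v, 'e) link set" where
  "cycles G l = {link_of A | A. 2 \<le> l \<and> is_arc G l A \<and> fst A ! 0 = fst A ! l \<and>
     sublink A 0 (l - 1) \<in> paths G (l - 1)}"

text \<open>The infimum of the empty set is \<open>\<infinity>\<close>.\<close>

definition girth :: "('v, 'e) mgraph \<Rightarrow> enat" where
  "girth G = Inf {enat n | n. cycles G n \<noteq> {}}"


section \<open>Path graphs\<close>

definition path_adjacent ::
    "('v, 'e) mgraph \<Rightarrow> nat \<Rightarrow> ('v, 'e) link \<Rightarrow> ('v, 'e) link \<Rightarrow> bool" where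
  "path_adjacent G l L R \<longleftrightarrow> L \<noteq> R \<and>
     (\<exists>Q. is_arc G (l + 1) Q \<and> link_of Q \<in> paths G (l + 1) \<union> cycles G (l + 1) \<and>
        {sublink Q 0 l, sublink Q 1 (l + 1)} = {L, R})"

text \<open>A simple graph: an edge is the set of its two ends.\<close>

definition path_graph ::
    "nat \<Rightarrow> ('v, 'e) mgraph \<Rightarrow> (('v, 'e) link, ('v, 'e) link set) mgraph" where
  "path_graph l G = \<lparr>verts = paths G l,
     edges = {{L, R} | L R. L \<in> paths G l \<and> R \<in> paths G l \<and> path_adjacent G l L R},
     ends = (\<lambda>e. e)\<rparr>"

end

theory Submission imports Defs begin

text \<open>If the girth of \<open>G\<close> is at least \<open>l + 1\<close>, walks without immediate reversal behave as
well as one can wish: one with \<open>l\<close> edges has no repeated vertex, and one with \<open>l + 1\<close>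
edges is a path or closes up to a cycle. So the vertices of the path graph are exactly the walks with
\<open>l\<close> edges, up to reversal, and two of them are adjacent as soon as one is the other shifted by
one edge along a longer walk. Each clique minor can therefore be sought among walks.

A clique minor is treated as a colouring of the vertices whose first \<open>t\<close> colour classes are
connected and pairwise adjacent; the remaining colours stand for deleted vertices
(\<open>minor_of_clique_colouring\<close>, \<open>clique_colouring_of_minor\<close>). In this form it can be
carried from walks with \<open>n\<close> edges to walks with \<open>n + 1\<close> edges. A walk \<open>Q\<close> with
\<open>n + 1\<close> edges takes the colour of one of the two shorter walks at its two ends. If this choice is
made so that every shorter walk can be extended at each of its ends to a longer walk of its own colour
(\<open>supports\<close>), then the classes of longer walks are again connected and adjacent
(\<open>clique_colouring_Suc\<close>): two extensions of \<open>A\<close> at the same end are both shifts of an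
extension at the other end. The point is that the choice can always be continued
(\<open>supports_Suc\<close>). Let \<open>A\<close> be a walk with \<open>n\<close> edges. By hypothesis it has a left
extension \<open>x\<^sub>0 A\<close> and a right extension \<open>A y\<^sub>0\<close> of its own colour. Give \<open>x A y\<^sub>0\<close> the
colour of \<open>x A\<close>, and \<open>x\<^sub>0 A y\<close> the colour of \<open>A y\<close>; the two rules agree on
\<open>x\<^sub>0 A y\<^sub>0\<close>. Then every \<open>x A\<close> has found a right extension of its colour, and every
\<open>A y\<close> a left one.

It remains to start the induction with single edges, that is, with a set \<open>F\<close> of edges coloured
such that the first classes are connected and pairwise incident, and such that walks with two edges can
be coloured as required. The latter is possible if at each vertex an edge of \<open>F\<close> meets a second
one of the same colour, or at least two further ones (\<open>continuable\<close>, \<open>supports_one\<close>):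
three edges at a vertex can choose each other cyclically.

For the degeneracy \<open>d \<ge> 3\<close>, take a subgraph of minimum degree \<open>d\<close>, and give \<open>d\<close>
edges at one vertex different colours; every other edge is a leftover.

For \<open>t = \<eta>(G) \<ge> 4\<close>, start from a colouring of vertices. If all degrees are at least three, colour an
edge within a class like that class, and an edge between two classes by a tournament in which every
colour beats another one, so that classes with a single vertex receive an edge too. A vertex of smaller
degree has a neighbour in its own class, since a class with a single vertex has at least three
edges. Contract an edge to this neighbour; an edge colouring of the contracted graph lifts, the
contracted edge copying the colour of the other edge at the vertex.

For \<open>t = 3\<close>, the edge colouring alone settles \<open>l = 1\<close>. If \<open>l \<ge> 2\<close>, some set of edges
has no leaf, so it carries an infinite walk, whose sections with \<open>l\<close> edges form a walk in the path
graph that never returns after one or two steps, and hence contains a cycle. For \<open>t \<le> 2\<close> and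
\<open>d \<le> 2\<close> the edge of the path graph suffices.\<close>

section \<open>Clique minors as vertex colourings\<close>

text \<open>One step of \<open>r\<close> inside \<open>X\<close>; its reflexive transitive closure is reachability in the subgraph
induced by \<open>X\<close>.\<close>

definition step_in :: "('a \<Rightarrow> 'a \<Rightarrow> bool) \<Rightarrow> 'a set \<Rightarrow> 'a \<Rightarrow> 'a \<Rightarrow> bool" where
  "step_in r X a b \<longleftrightarrow> a \<in> X \<and> b \<in> X \<and> r a b"

definition linked :: "('a \<Rightarrow> 'a \<Rightarrow> bool) \<Rightarrow> 'a set \<Rightarrow> bool" where
  "linked r X \<longleftrightarrow> (\<forall>x\<in>X. \<forall>y\<in>X. (step_in r X)\<^sup>*\<^sup>* x y)"

text \<open>A model of the complete graph on \<open>t\<close> vertices in the graph with adjacency \<open>r\<close>: the colours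
below \<open>t\<close> are its branch sets, and all other colours mark vertices outside the model. The relation is
a parameter because the same notion is used for vertices, for edges that share an end, and for walks.\<close>

definition clique_colouring :: "('a \<Rightarrow> 'a \<Rightarrow> bool) \<Rightarrow> 'a set \<Rightarrow> nat \<Rightarrow> ('a \<Rightarrow> nat) \<Rightarrow> bool" where
  "clique_colouring r V t f \<longleftrightarrow>
     (\<forall>i<t. {x \<in> V. f x = i} \<noteq> {} \<and> linked r {x \<in> V. f x = i}) \<and>
     (\<forall>i<t. \<forall>j<t. i \<noteq> j \<longrightarrow> (\<exists>x\<in>V. \<exists>y\<in>V. f x = i \<and> f y = j \<and> r x y))"

definition adj :: "('v, 'e) mgraph \<Rightarrow> 'v \<Rightarrow> 'v \<Rightarrow> bool" where
  "adj G x y \<longleftrightarrow> (\<exists>e\<in>edges G. ends G e = {x, y})"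

lemma adj_commute: "adj G x y \<longleftrightarrow> adj G y x"
  by (simp add: adj_def insert_commute)

lemma adj_verts: "graph G \<Longrightarrow> adj G x y \<Longrightarrow> x \<in> verts G \<and> y \<in> verts G \<and> x \<noteq> y"
  by (force simp: adj_def graph_def)

lemma graph_endsE:
  assumes "graph G" "e \<in> edges G"
  obtains x y where "ends G e = {x, y}" "x \<noteq> y" "x \<in> verts G" "y \<in> verts G"
  using assms by (fastforce simp: graph_def card_2_iff)

lemma graph_other_endE:
  assumes "graph G" "e \<in> edges G" "x \<in> ends G e"
  obtains y where "ends G e = {x, y}" "y \<noteq> x"
proof -
  obtain p q where pq: "ends G e = {p, q}" "p \<noteq> q"
    using assms(1,2) by (rule graph_endsE)
  then have "x = p \<or> x = q" using assms(3) by simp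
  then show ?thesis
    using that[of p] that[of q] pq by (auto simp: insert_commute)
qed

lemma linked_image:
  assumes "linked r X"
    and "\<And>a b. a \<in> X \<Longrightarrow> b \<in> X \<Longrightarrow> r a b \<Longrightarrow> h a = h b \<or> s (h a) (h b)"
  shows "linked s (h ` X)"
proof -
  have "(step_in s (h ` X))\<^sup>*\<^sup>* (h x) (h y)" if "(step_in r X)\<^sup>*\<^sup>* x y" for x y
    using that
  proof (induction rule: rtranclp_induct)
    case (step y z)
    then have "h y = h z \<or> step_in s (h ` X) (h y) (h z)"
      using assms(2) by (auto simp: step_in_def)
    then show ?case
      using step.IH by (metis rtranclp.rtrancl_into_rtrancl)
  qed simp
  then show ?thesis
    using assms(1) by (auto simp: linked_def)
qed

text \<open>Branch sets may be mapped forward along any map that respects the colours and never pulls adjacent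
vertices apart. Contraction of an edge inside a branch set is an instance, and so is the passage from
walks to links.\<close>

lemma clique_colouring_image:
  assumes col: "clique_colouring r V t f"
    and into: "h ` V \<subseteq> W"
    and compat: "\<And>a b. a \<in> V \<Longrightarrow> b \<in> V \<Longrightarrow> h a = h b \<Longrightarrow> f a = f b"
    and adj: "\<And>a b. a \<in> V \<Longrightarrow> b \<in> V \<Longrightarrow> r a b \<Longrightarrow> h a = h b \<or> s (h a) (h b)"
  shows "\<exists>f'. clique_colouring s W t f' \<and> (\<forall>x\<in>V. f' (h x) = f x)"
proof -
  define f' where "f' w = (if w \<in> h ` V then f (inv_into V h w) else t)" for w
  have f'_h: "f' (h x) = f x" if "x \<in> V" for x
  proof -
    have "inv_into V h (h x) \<in> V" "h (inv_into V h (h x)) = h x"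
      using that by (auto simp: inv_into_into f_inv_into_f)
    then show ?thesis
      using compat[of "inv_into V h (h x)" x] that by (simp add: f'_def)
  qed
  have cls: "{w \<in> W. f' w = i} = h ` {x \<in> V. f x = i}" if "i < t" for i
  proof
    show "{w \<in> W. f' w = i} \<subseteq> h ` {x \<in> V. f x = i}"
    proof
      fix w assume w: "w \<in> {w \<in> W. f' w = i}"
      then obtain x where "x \<in> V" "w = h x"
        using \<open>i < t\<close> by (auto simp: f'_def split: if_splits)
      then show "w \<in> h ` {x \<in> V. f x = i}"
        using w f'_h by auto
    qed
    show "h ` {x \<in> V. f x = i} \<subseteq> {w \<in> W. f' w = i}"
      using f'_h into by auto
  qed
  have "clique_colouring s W t f'"
    unfolding clique_colouring_def
  proof (intro conjI allI impI)
    fix i assume i: "i < t"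
    show "{w \<in> W. f' w = i} \<noteq> {}"
      using col i by (simp add: cls clique_colouring_def)
    have "linked r {x \<in> V. f x = i}"
      using col i by (simp add: clique_colouring_def)
    then show "linked s {w \<in> W. f' w = i}"
      unfolding cls[OF i] by (rule linked_image) (use adj in auto)
  next
    fix i j assume ij: "i < t" "j < t" "i \<noteq> j"
    then obtain x y where "x \<in> V" "y \<in> V" "f x = i" "f y = j" "r x y"
      using col unfolding clique_colouring_def by blast
    then show "\<exists>x\<in>W. \<exists>y\<in>W. f' x = i \<and> f' y = j \<and> s x y"
      using adj[of x y] f'_h ij into by (metis image_subset_iff)
  qed
  then show ?thesis using f'_h by blast
qed

text \<open>Conversely, branch sets may be pulled back if fibres, and adjacencies within a class, lift to paths
within the class. This undoes a contraction.\<close>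

lemma clique_colouring_preimage:
  assumes col: "clique_colouring s W t f"
    and onto: "h ` V = W"
    and conn: "\<And>a b. a \<in> V \<Longrightarrow> b \<in> V \<Longrightarrow> f (h a) = f (h b) \<Longrightarrow> h a = h b \<or> s (h a) (h b) \<Longrightarrow>
                 (step_in r {x \<in> V. f (h x) = f (h a)})\<^sup>*\<^sup>* a b"
    and adj: "\<And>w w'. w \<in> W \<Longrightarrow> w' \<in> W \<Longrightarrow> s w w' \<Longrightarrow> f w \<noteq> f w' \<Longrightarrow>
                 \<exists>a\<in>V. \<exists>b\<in>V. h a = w \<and> h b = w' \<and> r a b"
  shows "clique_colouring r V t (f \<circ> h)"
proof -
  have path: "\<forall>x\<in>V. \<forall>y\<in>V. h x = w \<longrightarrow> h y = w' \<longrightarrow> (step_in r {x \<in> V. f (h x) = i})\<^sup>*\<^sup>* x y"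
    if "(step_in s {w \<in> W. f w = i})\<^sup>*\<^sup>* w w'" "w \<in> W" "f w = i" for i w w'
    using that(1)
  proof (induction rule: rtranclp_induct)
    case base
    then show ?case
      using conn that by fastforce
  next
    case (step w1 w2)
    from step.hyps(2) have w12: "w1 \<in> W" "w2 \<in> W" "f w1 = i" "f w2 = i" "s w1 w2"
      by (auto simp: step_in_def)
    then obtain z where z: "z \<in> V" "h z = w1"
      using onto by auto
    show ?case
    proof (intro ballI impI)
      fix x y assume xy: "x \<in> V" "y \<in> V" "h x = w" "h y = w2"
      have "(step_in r {x \<in> V. f (h x) = i})\<^sup>*\<^sup>* x z"
        using step.IH xy z by blast
      moreover have "(step_in r {x \<in> V. f (h x) = i})\<^sup>*\<^sup>* z y"
        using conn[of z y] z xy w12 by auto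
      ultimately show "(step_in r {x \<in> V. f (h x) = i})\<^sup>*\<^sup>* x y"
        by (rule rtranclp_trans)
    qed
  qed
  show ?thesis
    unfolding clique_colouring_def
  proof (intro conjI allI impI)
    fix i assume i: "i < t"
    then have "{w \<in> W. f w = i} \<noteq> {}" and lk: "linked s {w \<in> W. f w = i}"
      using col by (auto simp: clique_colouring_def)
    then show "{x \<in> V. (f \<circ> h) x = i} \<noteq> {}"
      using onto by auto
    show "linked r {x \<in> V. (f \<circ> h) x = i}"
      unfolding linked_def
    proof (intro ballI)
      fix x y assume "x \<in> {x \<in> V. (f \<circ> h) x = i}" "y \<in> {x \<in> V. (f \<circ> h) x = i}"
      then have xy: "x \<in> V" "y \<in> V" "f (h x) = i" "f (h y) = i" by auto
      then have hW: "h x \<in> W" "h y \<in> W" using onto by auto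
      then have "(step_in s {w \<in> W. f w = i})\<^sup>*\<^sup>* (h x) (h y)"
        using lk xy by (auto simp: linked_def)
      then show "(step_in r {x \<in> V. (f \<circ> h) x = i})\<^sup>*\<^sup>* x y"
        using path xy hW by simp
    qed
  next
    fix i j assume "i < t" "j < t" "i \<noteq> j"
    then obtain w w' where "w \<in> W" "w' \<in> W" "f w = i" "f w' = j" "s w w'"
      using col unfolding clique_colouring_def by blast
    then show "\<exists>x\<in>V. \<exists>y\<in>V. (f \<circ> h) x = i \<and> (f \<circ> h) y = j \<and> r x y"
      using adj[of w w'] \<open>i \<noteq> j\<close> by fastforce
  qed
qed

lemma clique_colouring_coloured:
  assumes "clique_colouring r V t f"
  shows "clique_colouring r {x \<in> V. f x < t} t f"
proof -
  have "{x \<in> {x \<in> V. f x < t}. f x = i} = {x \<in> V. f x = i}" if "i < t" for i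
    using that by auto
  with assms show ?thesis
    unfolding clique_colouring_def by simp blast
qed

lemma clique_colouring_subgraph:
  assumes "clique_colouring (adj S) (verts S) t f" and "subgraph S G"
  shows "\<exists>f'. clique_colouring (adj G) (verts G) t f'"
proof -
  have "id ` verts S \<subseteq> verts G" "\<And>a b. adj S a b \<Longrightarrow> adj G a b"
    using assms(2) by (fastforce simp: subgraph_def adj_def)+
  then show ?thesis
    using clique_colouring_image[OF assms(1), where h = id and s = "adj G" and W = "verts G"] by auto
qed

definition induced :: "('v, 'e) mgraph \<Rightarrow> 'v set \<Rightarrow> ('v, 'e) mgraph" where
  "induced G W = \<lparr>verts = W, edges = {e \<in> edges G. ends G e \<subseteq> W}, ends = ends G\<rparr>"

lemma subgraph_induced: "graph G \<Longrightarrow> W \<subseteq> verts G \<Longrightarrow> subgraph (induced G W) G"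
  by (auto simp: subgraph_def graph_def induced_def finite_subset)

lemma clique_colouring_induced:
  assumes "clique_colouring (adj G) (verts G) t f"
  defines "W \<equiv> {x \<in> verts G. f x < t}"
  shows "\<exists>f'. clique_colouring (adj (induced G W)) W t f' \<and> (\<forall>x\<in>W. f' x < t)"
proof -
  have "\<exists>f'. clique_colouring (adj (induced G W)) W t f' \<and> (\<forall>x\<in>W. f' (id x) = f x)"
    by (rule clique_colouring_image[OF clique_colouring_coloured[OF assms(1), folded W_def]])
       (auto simp: adj_def induced_def)
  then show ?thesis by (auto simp: W_def)
qed

lemma subgraph_trans: "subgraph S H \<Longrightarrow> subgraph H G \<Longrightarrow> subgraph S G"
  by (auto simp: subgraph_def subset_iff)

abbreviation merge :: "'v \<Rightarrow> 'v \<Rightarrow> 'v \<Rightarrow> 'v" where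
  "merge u v \<equiv> \<lambda>x. if x = v then u else x"

lemma graph_contract:
  assumes "graph G" and "u \<in> verts G" and "u \<noteq> v"
  shows "graph (contract G u v)"
proof -
  have "merge u v ` ends G e \<subseteq> verts G - {v} \<and> card (merge u v ` ends G e) = 2"
    if e: "e \<in> edges G" "ends G e \<noteq> {u, v}" for e
  proof -
    obtain p q where pq: "ends G e = {p, q}" "p \<noteq> q" "p \<in> verts G" "q \<in> verts G"
      using assms(1) e(1) by (rule graph_endsE)
    moreover have "p = v \<Longrightarrow> q \<noteq> u" "q = v \<Longrightarrow> p \<noteq> u"
      using pq e(2) by auto
    ultimately show ?thesis
      using assms by (cases "p = v"; cases "q = v") simp_all
  qed
  then show ?thesis
    using assms by (simp add: graph_def contract_def)
qed

lemma clique_colouring_contract: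
  assumes col: "clique_colouring (adj G) (verts G) t f"
    and uv: "u \<in> verts G" "u \<noteq> v" "f u = f v"
  shows "\<exists>f'. clique_colouring (adj (contract G u v)) (verts (contract G u v)) t f' \<and>
              (\<forall>x\<in>verts G. f' (merge u v x) = f x)"
proof (rule clique_colouring_image[OF col, where h = "merge u v"])
  fix a b assume "adj G a b"
  then obtain e where e: "e \<in> edges G" "ends G e = {a, b}"
    by (auto simp: adj_def)
  show "merge u v a = merge u v b \<or> adj (contract G u v) (merge u v a) (merge u v b)"
  proof (cases "{a, b} = {u, v}")
    case True
    then show ?thesis by (auto simp: doubleton_eq_iff)
  next
    case False
    then have "e \<in> edges (contract G u v)" "ends (contract G u v) e = {merge u v a, merge u v b}"
      using e by (auto simp: contract_def)
    then show ?thesis unfolding adj_def by blast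
  qed
qed (use uv in \<open>auto simp: contract_def split: if_splits\<close>)

text \<open>The fibres of a contraction are single vertices, except for the two ends of the contracted edge, which
are adjacent. So a colouring is pulled back along the merging map.\<close>

lemma clique_colouring_uncontract:
  assumes g: "graph G" and e: "e \<in> edges G" "ends G e = {u, v}"
    and col: "clique_colouring (adj (contract G u v)) (verts (contract G u v)) t f"
  shows "\<exists>f'. clique_colouring (adj G) (verts G) t f'"
proof -
  have uv: "u \<in> verts G" "v \<in> verts G" "u \<noteq> v" "adj G u v"
    using adj_verts[OF g, of u v] e by (auto simp: adj_def)
  define m where "m = merge u v"
  have m_eq: "m x = m y \<Longrightarrow> x = y \<or> {x, y} = {u, v}" for x y
    by (auto simp: m_def split: if_splits)
  have lift: "\<exists>p q. adj G p q \<and> m p = x \<and> m q = y" if "adj (contract G u v) x y" for x y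
  proof -
    from that obtain e' where e': "e' \<in> edges G" "m ` ends G e' = {x, y}"
      by (auto simp: adj_def contract_def m_def)
    obtain p q where pq: "ends G e' = {p, q}"
      using g e'(1) by (rule graph_endsE)
    with e' have "adj G p q" "adj G q p"
      by (auto simp: adj_def insert_commute)
    moreover have "(m p = x \<and> m q = y) \<or> (m q = x \<and> m p = y)"
      using e'(2) unfolding pq image_insert image_empty doubleton_eq_iff by blast
    ultimately show ?thesis by blast
  qed
  have fibre: "(step_in (adj G) {x \<in> verts G. f (m x) = i})\<^sup>*\<^sup>* a b"
    if "a \<in> verts G" "b \<in> verts G" "m a = m b" "f (m a) = i" for a b i
  proof (cases "a = b")
    case False
    then have "{a, b} = {u, v}" using m_eq that(3) by blast
    then have "adj G a b" using e by (auto simp: adj_def)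
    then show ?thesis
      using that by (intro r_into_rtranclp) (simp add: step_in_def)
  qed simp
  have "clique_colouring (adj G) (verts G) t (f \<circ> m)"
  proof (rule clique_colouring_preimage[OF col])
    show "m ` verts G = verts (contract G u v)"
      using uv by (auto simp: contract_def m_def)
  next
    fix a b assume ab: "a \<in> verts G" "b \<in> verts G" "f (m a) = f (m b)"
      and "m a = m b \<or> adj (contract G u v) (m a) (m b)"
    then consider "m a = m b" | "adj (contract G u v) (m a) (m b)" by blast
    then show "(step_in (adj G) {x \<in> verts G. f (m x) = f (m a)})\<^sup>*\<^sup>* a b"
    proof cases
      case 1
      then show ?thesis using fibre ab by simp
    next
      case 2
      then obtain p q where pq: "adj G p q" "m p = m a" "m q = m b"
        using lift by blast
      have pq': "p \<in> verts G" "q \<in> verts G" using adj_verts[OF g pq(1)] by auto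
      let ?R = "step_in (adj G) {x \<in> verts G. f (m x) = f (m a)}"
      have "?R\<^sup>*\<^sup>* a p" "?R\<^sup>*\<^sup>* q b"
        using fibre[of a p] fibre[of q b] ab pq pq' by simp_all
      moreover have "?R p q"
        using pq pq' ab by (simp add: step_in_def)
      ultimately show ?thesis
        by (meson converse_rtranclp_into_rtranclp rtranclp_trans)
    qed
  next
    fix w w' assume "adj (contract G u v) w w'"
    then obtain p q where pq: "adj G p q" "m p = w" "m q = w'"
      using lift by blast
    then show "\<exists>a\<in>verts G. \<exists>b\<in>verts G. m a = w \<and> m b = w' \<and> adj G a b"
      using adj_verts[OF g pq(1)] by blast
  qed
  then show ?thesis by blast
qed

lemma clique_colouring_of_minor:
  assumes g: "graph G" and minor: "has_minor G (complete_graph t)"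
  shows "\<exists>f. clique_colouring (adj G) (verts G) t f"
proof -
  obtain S M where S: "subgraph S G" and SM: "contracts_edge\<^sup>*\<^sup>* S M"
    and iso: "isomorphic M (complete_graph t)"
    using minor by (auto simp: has_minor_def)
  obtain \<phi> \<psi> where \<phi>: "bij_betw \<phi> (verts M) {..<t}"
    and \<psi>: "bij_betw \<psi> (edges M) {e. e \<subseteq> {..<t} \<and> card e = 2}"
    and ends: "\<And>e. e \<in> edges M \<Longrightarrow> \<psi> e = \<phi> ` ends M e"
    using iso by (auto simp: isomorphic_def complete_graph_def)
  have gS: "graph S" using S by (simp add: subgraph_def)
  have gM: "graph M" using SM
  proof (induction rule: rtranclp_induct)
    case (step M M')
    then obtain e u v where e: "e \<in> edges M" "ends M e = {u, v}" "M' = contract M u v"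
      by (auto simp: contracts_edge_def)
    then have "u \<in> verts M" "u \<noteq> v"
      using adj_verts[OF step.IH, of u v] by (auto simp: adj_def)
    then show ?case using graph_contract step.IH e by simp
  qed (rule gS)
  have "clique_colouring (adj M) (verts M) t \<phi>"
    unfolding clique_colouring_def
  proof (intro conjI allI impI)
    fix i assume i: "i < t"
    then obtain x where x: "x \<in> verts M" "\<phi> x = i"
      using \<phi> by (metis bij_betw_iff_bijections lessThan_iff)
    then show "{x \<in> verts M. \<phi> x = i} \<noteq> {}" by auto
    have "{x \<in> verts M. \<phi> x = i} = {x}"
      using \<phi> x by (auto simp: bij_betw_def dest: inj_onD)
    then show "linked (adj M) {x \<in> verts M. \<phi> x = i}"
      by (simp add: linked_def)
  next
    fix i j assume ij: "i < t" "j < t" "i \<noteq> j"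
    then have "{i, j} \<in> \<psi> ` edges M"
      unfolding bij_betw_imp_surj_on[OF \<psi>] by simp
    then obtain e where e: "e \<in> edges M" "\<psi> e = {i, j}"
      by (auto simp only: image_iff)
    obtain p q where pq: "ends M e = {p, q}" "p \<in> verts M" "q \<in> verts M"
      using gM e(1) by (rule graph_endsE)
    then have "\<phi> p = i \<and> \<phi> q = j \<or> \<phi> p = j \<and> \<phi> q = i"
      using ends[OF e(1)] e(2) by (auto simp: doubleton_eq_iff)
    moreover have "adj M p q" "adj M q p"
      using e pq by (auto simp: adj_def insert_commute)
    ultimately show "\<exists>x\<in>verts M. \<exists>y\<in>verts M. \<phi> x = i \<and> \<phi> y = j \<and> adj M x y"
      using pq by blast
  qed
  then have "\<exists>f. clique_colouring (adj M) (verts M) t f" by blast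
  with SM gS have "\<exists>f. clique_colouring (adj S) (verts S) t f"
  proof (induction rule: converse_rtranclp_induct)
    case (step S S')
    then obtain e u v where e: "e \<in> edges S" "ends S e = {u, v}" "S' = contract S u v"
      by (auto simp: contracts_edge_def)
    moreover from e have "u \<in> verts S" "u \<noteq> v"
      using adj_verts[OF step.prems(1), of u v] by (auto simp: adj_def)
    ultimately show ?case
      using step graph_contract clique_colouring_uncontract by metis
  qed
  then show ?thesis
    using clique_colouring_subgraph S by blast
qed

lemma linked_neighbour:
  assumes "linked r X" "x \<in> X" "y \<in> X" "x \<noteq> y"
  obtains z where "z \<in> X" "r x z"
proof -
  have "(step_in r X)\<^sup>*\<^sup>* x y" using assms by (simp add: linked_def)
  then show ?thesis
    using assms(4) that by (cases rule: converse_rtranclpE) (auto simp: step_in_def)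
qed

text \<open>If every class is a single vertex, the complete graph is a subgraph: one edge is kept for every pair of
colours, since parallel edges would spoil the isomorphism.\<close>

lemma minor_of_injective_clique_colouring:
  assumes g: "graph G" and col: "clique_colouring (adj G) (verts G) t f"
    and below: "\<forall>x\<in>verts G. f x < t" and inj: "inj_on f (verts G)"
  shows "\<exists>S. subgraph S G \<and> verts S = verts G \<and> ends S = ends G \<and> isomorphic S (complete_graph t)"
proof -
  let ?P = "{e. e \<subseteq> {..<t} \<and> card e = 2}"
  have "\<exists>e. e \<in> edges G \<and> f ` ends G e = p" if "p \<in> ?P" for p
  proof -
    from that obtain i j where p: "p = {i, j}" "i < t" "j < t" "i \<noteq> j"
      by (auto simp: card_2_iff)
    then obtain x y where "x \<in> verts G" "y \<in> verts G" "f x = i" "f y = j" "adj G x y"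
      using col unfolding clique_colouring_def by blast
    then show ?thesis using p by (auto simp: adj_def)
  qed
  then obtain \<epsilon> where \<epsilon>: "\<And>p. p \<in> ?P \<Longrightarrow> \<epsilon> p \<in> edges G \<and> f ` ends G (\<epsilon> p) = p"
    by metis
  define S where "S = \<lparr>verts = verts G, edges = \<epsilon> ` ?P, ends = ends G\<rparr>"
  have "finite ?P" by (rule finite_subset[of _ "Pow {..<t}"]) auto
  then have "subgraph S G"
    using g \<epsilon> by (auto simp: S_def subgraph_def graph_def)
  moreover have "isomorphic S (complete_graph t)"
    unfolding isomorphic_def
  proof (intro exI conjI)
    have "f ` verts G = {..<t}"
    proof
      show "{..<t} \<subseteq> f ` verts G"
      proof
        fix i assume i: "i \<in> {..<t}"
        then have "{x \<in> verts G. f x = i} \<noteq> {}" using col by (simp add: clique_colouring_def)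
        then show "i \<in> f ` verts G" using i by auto
      qed
    qed (use below in auto)
    then show "bij_betw f (verts S) (verts (complete_graph t))"
      using inj by (simp add: S_def complete_graph_def bij_betw_def)
    have "(\<lambda>e. f ` ends G e) ` \<epsilon> ` ?P = (\<lambda>p. p) ` ?P"
      unfolding image_image by (rule image_cong) (simp_all add: \<epsilon>)
    moreover have "inj_on (\<lambda>e. f ` ends G e) (\<epsilon> ` ?P)"
      by (rule inj_onI) (use \<epsilon> in \<open>metis (no_types, lifting) imageE\<close>)
    ultimately show "bij_betw (\<lambda>e. f ` ends G e) (edges S) (edges (complete_graph t))"
      by (simp add: S_def complete_graph_def bij_betw_def)
    show "\<forall>e\<in>edges S. ends (complete_graph t) (f ` ends G e) = f ` ends S e"
      by (simp add: S_def complete_graph_def)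
  qed
  ultimately show ?thesis by (auto simp: S_def)
qed

text \<open>Contract edges inside classes until every class is a single vertex. The edges that are kept have to
be selected at the end, yet a minor starts from a subgraph; so the statement returns a subgraph \<open>S\<close>
of the uncontracted graph, and asks that it has all vertices and the very function \<open>ends G\<close>, so that
a contraction can be undone with an equality of records.\<close>

lemma spanning_minor_of_clique_colouring:
  assumes "graph G" and "clique_colouring (adj G) (verts G) t f" and "\<forall>x\<in>verts G. f x < t"
  shows "\<exists>S M. subgraph S G \<and> verts S = verts G \<and> ends S = ends G \<and>
            contracts_edge\<^sup>*\<^sup>* S M \<and> isomorphic M (complete_graph t)"
  using assms
proof (induction "card (verts G)" arbitrary: G f rule: less_induct)
  case less
  note g = less.prems(1) and col = less.prems(2) and below = less.prems(3)
  show ?case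
  proof (cases "inj_on f (verts G)")
    case True
    then show ?thesis
      using minor_of_injective_clique_colouring[OF g col below] by blast
  next
    case False
    then obtain v y where vy: "v \<in> verts G" "y \<in> verts G" "f v = f y" "v \<noteq> y"
      by (auto simp: inj_on_def)
    then have "linked (adj G) {x \<in> verts G. f x = f v}"
      using col below by (simp add: clique_colouring_def)
    then obtain u where "u \<in> {x \<in> verts G. f x = f v}" and vu: "adj G v u"
      by (rule linked_neighbour[where x = v and y = y]) (use vy in auto)
    then have u: "u \<in> verts G" "f u = f v" by auto
    have "u \<noteq> v" using adj_verts[OF g] vu by metis
    obtain e where e: "e \<in> edges G" "ends G e = {u, v}"
      using vu by (auto simp: adj_def insert_commute)
    let ?G' = "contract G u v"
    obtain f' where f': "clique_colouring (adj ?G') (verts ?G') t f'"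
        and f'_merge: "\<forall>x\<in>verts G. f' (merge u v x) = f x"
      using clique_colouring_contract[OF col u(1) \<open>u \<noteq> v\<close> u(2)] by blast
    have "f' x < t" if "x \<in> verts ?G'" for x
      using that f'_merge below by (force simp: contract_def)
    moreover have "card (verts ?G') < card (verts G)"
      using g vy unfolding contract_def graph_def by (simp add: card_Diff1_less del: card_Diff_insert)
    ultimately obtain S M where S: "subgraph S ?G'" "verts S = verts ?G'" "ends S = ends ?G'"
      and M: "contracts_edge\<^sup>*\<^sup>* S M" "isomorphic M (complete_graph t)"
      using less.hyps[of ?G' f'] graph_contract[OF g u(1) \<open>u \<noteq> v\<close>] f' by blast
    \<comment> \<open>\<open>S\<close> with the contracted edge put back and with the ends read in \<open>G\<close>; contracting
      \<open>e\<close> in \<open>T\<close> leads back to \<open>S\<close>.\<close>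
    define T where "T = \<lparr>verts = verts G, edges = insert e (edges S), ends = ends G\<rparr>"
    have eS: "edges S \<subseteq> {x \<in> edges G. ends G x \<noteq> {u, v}}"
      using S(1) by (auto simp: subgraph_def contract_def)
    then have "subgraph T G"
      using g e by (auto simp: subgraph_def graph_def T_def finite_subset)
    moreover have "contract T u v = S"
      using S(2,3) eS e by (cases S) (auto simp: contract_def T_def)
    then have "contracts_edge T S"
      unfolding contracts_edge_def by (intro bexI[of _ e] exI[of _ u] exI[of _ v]) (auto simp: T_def e)
    then have "contracts_edge\<^sup>*\<^sup>* T M" using M(1) by (rule converse_rtranclp_into_rtranclp)
    moreover have "ends T = ends G" "verts T = verts G" by (simp_all add: T_def)
    ultimately show ?thesis using M(2) by blast
  qed
qed

lemma minor_of_clique_colouring: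
  assumes g: "graph G" and col: "clique_colouring (adj G) (verts G) t f"
  shows "has_minor G (complete_graph t)"
proof -
  let ?H = "induced G {x \<in> verts G. f x < t}"
  obtain f' where f': "clique_colouring (adj ?H) (verts ?H) t f'" "\<forall>x\<in>verts ?H. f' x < t"
    using clique_colouring_induced[OF col] by (auto simp: induced_def)
  have H: "subgraph ?H G" using subgraph_induced[OF g] by simp
  then have "graph ?H" by (simp add: subgraph_def)
  then obtain S M where "subgraph S ?H" "contracts_edge\<^sup>*\<^sup>* S M" "isomorphic M (complete_graph t)"
    using spanning_minor_of_clique_colouring[OF _ f'] by blast
  then show ?thesis
    unfolding has_minor_def using subgraph_trans[OF _ H] by blast
qed

text \<open>The bound that makes the maximum in the definition of \<open>hadwiger\<close> meaningful.\<close>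

lemma clique_colouring_le_card:
  assumes "finite V" and "clique_colouring r V t f"
  shows "t \<le> card V"
proof -
  have "{..<t} \<subseteq> f ` V"
    using assms(2) by (fastforce simp: clique_colouring_def)
  then show ?thesis
    using assms(1) by (metis card_lessThan card_image_le card_mono finite_imageI order_trans)
qed

lemma finite_clique_minors:
  assumes "graph G"
  shows "finite {t. has_minor G (complete_graph t)}"
proof -
  have "{t. has_minor G (complete_graph t)} \<subseteq> {..card (verts G)}"
    using clique_colouring_of_minor[OF assms] clique_colouring_le_card assms
    by (fastforce simp: graph_def)
  then show ?thesis by (rule finite_subset) simp
qed

lemma le_hadwigerI:
  assumes "graph G" and "clique_colouring (adj G) (verts G) t f"
  shows "t \<le> hadwiger G"
  unfolding hadwiger_def
  using finite_clique_minors minor_of_clique_colouring assms by (intro Max_ge) auto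

lemma hadwiger_clique_colouring:
  assumes "graph G"
  obtains f where "clique_colouring (adj G) (verts G) (hadwiger G) f"
proof -
  have "has_minor G (complete_graph 0)"
    by (rule minor_of_clique_colouring[OF assms, of 0 "\<lambda>_. 0"]) (simp add: clique_colouring_def)
  then have "hadwiger G \<in> {t. has_minor G (complete_graph t)}"
    unfolding hadwiger_def using finite_clique_minors[OF assms] by (intro Max_in) auto
  then show ?thesis
    using clique_colouring_of_minor[OF assms] that by blast
qed


section \<open>Edge colourings\<close>

definition meets :: "('v, 'e) mgraph \<Rightarrow> 'e \<Rightarrow> 'e \<Rightarrow> bool" where
  "meets G e f \<longleftrightarrow> ends G e \<inter> ends G f \<noteq> {}"

text \<open>No edge of \<open>F\<close> has an end at which a walk in \<open>F\<close> would have to stop.\<close>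

definition leafless :: "('v, 'e) mgraph \<Rightarrow> 'e set \<Rightarrow> bool" where
  "leafless G F \<longleftrightarrow> (\<forall>e\<in>F. \<forall>x\<in>ends G e. \<exists>f\<in>F. f \<noteq> e \<and> x \<in> ends G f)"

text \<open>The condition under which walks with two edges can be coloured so that each edge has, at each end, an
extension of its own colour. At a vertex with exactly two edges of \<open>F\<close> there is only one such walk
for both edges, so they must have equal colours; at a vertex with three or more edges any colours will
do.\<close>

definition continuable :: "('v, 'e) mgraph \<Rightarrow> 'e set \<Rightarrow> ('e \<Rightarrow> nat) \<Rightarrow> bool" where
  "continuable G F c \<longleftrightarrow> (\<forall>e\<in>F. \<forall>x\<in>ends G e. \<exists>f\<in>F. f \<noteq> e \<and> x \<in> ends G f \<and>
     (c f = c e \<or> (\<exists>g\<in>F. g \<noteq> e \<and> g \<noteq> f \<and> x \<in> ends G g)))"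

lemma clique_colouring_mono:
  assumes "clique_colouring r V t f" and "\<And>a b. a \<in> V \<Longrightarrow> b \<in> V \<Longrightarrow> r a b \<Longrightarrow> s a b"
  shows "clique_colouring s V t f"
proof -
  have "linked s {x \<in> V. f x = i}" if "linked r {x \<in> V. f x = i}" for i
    using linked_image[OF that, of id s] assms(2) by auto
  then show ?thesis
    using assms unfolding clique_colouring_def by blast
qed

lemma card_ge_2: "finite S \<Longrightarrow> a \<in> S \<Longrightarrow> b \<in> S \<Longrightarrow> a \<noteq> b \<Longrightarrow> 2 \<le> card S"
  using card_mono[of S "{a, b}"] by simp

lemma card_ge_3:
  "finite S \<Longrightarrow> a \<in> S \<Longrightarrow> b \<in> S \<Longrightarrow> c \<in> S \<Longrightarrow> a \<noteq> b \<Longrightarrow> a \<noteq> c \<Longrightarrow> b \<noteq> c \<Longrightarrow> 3 \<le> card S"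
  using card_mono[of S "{a, b, c}"] by simp

lemma card_less_imp_ex_notin: "finite T \<Longrightarrow> card T < card S \<Longrightarrow> \<exists>x\<in>S. x \<notin> T"
  using card_mono[of T S] by fastforce

text \<open>A class with more than one vertex is connected, which gives a neighbour; a class with one vertex must
meet all other classes by its own edges.\<close>

lemma class_neighbour_or_spokes:
  assumes "clique_colouring (adj G) (verts G) t f" "v \<in> verts G" "f v < t"
  obtains (neighbour) u where "u \<in> verts G" "f u = f v" "adj G v u"
  | (spokes) "\<And>j. j < t \<Longrightarrow> j \<noteq> f v \<Longrightarrow> \<exists>y. f y = j \<and> adj G v y"
proof (cases "{x \<in> verts G. f x = f v} = {v}")
  case True
  have "\<exists>y. f y = j \<and> adj G v y" if "j < t" "j \<noteq> f v" for j
  proof -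
    have "\<exists>x\<in>verts G. \<exists>y\<in>verts G. f x = f v \<and> f y = j \<and> adj G x y"
      using assms that by (simp add: clique_colouring_def)
    then obtain x y where "x \<in> verts G" "f x = f v" "f y = j" "adj G x y" by blast
    then show ?thesis using True by auto
  qed
  then show ?thesis by (rule spokes)
next
  case False
  then obtain y where "y \<in> verts G" "f y = f v" "v \<noteq> y" using assms by auto
  moreover have "linked (adj G) {x \<in> verts G. f x = f v}"
    using assms by (simp add: clique_colouring_def)
  ultimately obtain u where "u \<in> {x \<in> verts G. f x = f v}" "adj G v u"
    using linked_neighbour[of "adj G" "{x \<in> verts G. f x = f v}" v y] assms(2) by blast
  then show ?thesis using neighbour by blast
qed

text \<open>Edges to different classes have different other ends.\<close>

lemma degree_of_spokes:
  assumes g: "graph G" and spokes: "\<And>j. j < t \<Longrightarrow> j \<noteq> i \<Longrightarrow> \<exists>y. f y = j \<and> adj G v y"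
  shows "t - 1 \<le> degree G v"
proof -
  let ?E = "{e \<in> edges G. v \<in> ends G e}" and ?o = "\<lambda>e. THE y. ends G e = {v, y}"
  have fin: "finite ?E" using g by (simp add: graph_def)
  have "{..<t} - {i} \<subseteq> (\<lambda>e. f (?o e)) ` ?E"
  proof
    fix j assume j: "j \<in> {..<t} - {i}"
    then obtain y e where "f y = j" "e \<in> edges G" "ends G e = {v, y}"
      using spokes[of j] by (auto simp: adj_def)
    moreover from this have "?o e = y" by (auto simp: doubleton_eq_iff)
    ultimately show "j \<in> (\<lambda>e. f (?o e)) ` ?E" by (auto intro!: image_eqI[of _ _ e])
  qed
  then have "card ({..<t} - {i}) \<le> card ?E"
    using fin by (metis (no_types, lifting) card_image_le card_mono finite_imageI order_trans)
  then show ?thesis by (auto simp: degree_def card_Diff_singleton_if split: if_splits)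
qed

text \<open>Induction on the number of vertices. A vertex of degree less than \<open>k < t\<close> cannot be a class of its
own, by \<open>degree_of_spokes\<close>, hence can be contracted into its class. What remains is a graph in
which all vertices belong to classes and have degree at least \<open>k\<close>.\<close>

lemma clique_colouring_reduction [consumes 3, case_names subgraph contract large_degree]:
  assumes "graph G" and "clique_colouring (adj G) (verts G) t f" and k: "k < t"
    and sub: "\<And>H G. subgraph H G \<Longrightarrow> P H \<Longrightarrow> P G"
    and contract: "\<And>G e u v. graph G \<Longrightarrow> e \<in> edges G \<Longrightarrow> ends G e = {u, v} \<Longrightarrow> degree G v < k \<Longrightarrow>
                     P (contract G u v) \<Longrightarrow> P G"
    and base: "\<And>G f. graph G \<Longrightarrow> clique_colouring (adj G) (verts G) t f \<Longrightarrow>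
                 \<forall>x\<in>verts G. f x < t \<Longrightarrow> \<forall>x\<in>verts G. k \<le> degree G x \<Longrightarrow> P G"
  shows "P G"
  using assms(1,2)
proof (induction "card (verts G)" arbitrary: G f rule: less_induct)
  case less
  note g = less.prems(1) and col = less.prems(2)
  have fin: "finite (verts G)" using g by (simp add: graph_def)
  consider (uncoloured) x where "x \<in> verts G" "f x \<ge> t"
    | (small) v where "v \<in> verts G" "f v < t" "degree G v < k"
    | (large) "\<forall>x\<in>verts G. f x < t \<and> k \<le> degree G x"
    by (meson not_le)
  then show ?case
  proof cases
    case (uncoloured x)
    define W where "W = {x \<in> verts G. f x < t}"
    have "W \<subseteq> verts G" "x \<notin> W" using uncoloured by (simp_all add: W_def)
    then have "W \<subset> verts G" using uncoloured(1) by blast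
    then have "card W < card (verts G)" using fin by (rule psubset_card_mono[rotated])
    moreover have H: "subgraph (induced G W) G"
      by (rule subgraph_induced) (use g in \<open>auto simp: W_def\<close>)
    moreover obtain f' where "clique_colouring (adj (induced G W)) W t f'"
      using clique_colouring_induced[OF col] unfolding W_def by blast
    ultimately have "P (induced G W)"
      by (intro less.hyps[of _ f']) (auto simp: induced_def subgraph_def)
    then show ?thesis using sub[OF H] by simp
  next
    case (small v)
    obtain u where u: "u \<in> verts G" "f u = f v" "adj G v u"
    proof (cases rule: class_neighbour_or_spokes[OF col small(1,2), case_names neighbour spokes])
      case spokes
      then have "t - 1 \<le> degree G v" using degree_of_spokes[OF g, of t "f v" f v] by blast
      then show ?thesis using small(3) k by simp
    qed (use that in blast)
    then obtain e where e: "e \<in> edges G" "ends G e = {u, v}"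
      by (auto simp: adj_def insert_commute)
    have "u \<noteq> v" using adj_verts[OF g u(3)] by blast
    obtain f' where f': "clique_colouring (adj (contract G u v)) (verts (contract G u v)) t f'"
      using clique_colouring_contract[OF col u(1) \<open>u \<noteq> v\<close> u(2)] by blast
    have "card (verts (contract G u v)) < card (verts G)"
      using fin small(1) by (simp add: contract_def card_Diff1_less del: card_Diff_insert)
    then have "P (contract G u v)"
      using less.hyps graph_contract[OF g u(1) \<open>u \<noteq> v\<close>] f' by blast
    then show ?thesis by (rule contract[OF g e small(3)])
  next
    case large
    then show ?thesis using base[OF g col] by simp
  qed
qed

text \<open>With \<open>k = 2\<close>, a contracted vertex is a leaf: its edge disappears, and the edges found in the contracted
graph keep their ends.\<close>

lemma leafless_edge_set:
  assumes "graph G" and "clique_colouring (adj G) (verts G) t f" and "t \<ge> 3"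
  shows "\<exists>F. F \<noteq> {} \<and> F \<subseteq> edges G \<and> leafless G F"
proof -
  have "2 < t" using assms(3) by simp
  from assms(1,2) this show ?thesis
  proof (induction rule: clique_colouring_reduction)
    case (subgraph H G)
    then obtain F where F: "F \<noteq> {}" "F \<subseteq> edges H" "leafless H F" by blast
    then have "\<forall>e\<in>F. ends H e = ends G e" "F \<subseteq> edges G"
      using subgraph by (auto simp: subgraph_def)
    then show ?case using F by (intro exI[of _ F]) (simp add: leafless_def)
  next
    case (contract G e u v)
    then obtain F where F: "F \<noteq> {}" "F \<subseteq> edges (contract G u v)" "leafless (contract G u v) F" by blast
    have "ends (contract G u v) x = ends G x" if "x \<in> F" for x
    proof -
      have x: "x \<in> edges G" "x \<noteq> e" using that F contract by (auto simp: contract_def)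
      have "v \<notin> ends G x"
        using card_ge_2[of "{e \<in> edges G. v \<in> ends G e}" x e] x contract
        by (auto simp: graph_def degree_def)
      then show ?thesis by (auto simp: contract_def)
    qed
    moreover have "F \<subseteq> edges G" using F by (auto simp: contract_def)
    ultimately show ?case using F by (intro exI[of _ F]) (simp add: leafless_def)
  next
    case (large_degree G f)
    have "\<exists>f\<in>edges G. f \<noteq> e \<and> x \<in> ends G f" if "e \<in> edges G" "x \<in> ends G e" for e x
    proof -
      have "x \<in> verts G" using that large_degree(1) by (auto simp: graph_def)
      then have "2 \<le> card {e \<in> edges G. x \<in> ends G e}"
        using large_degree(4) by (simp add: degree_def)
      then show ?thesis
        using card_less_imp_ex_notin[of "{e}" "{e \<in> edges G. x \<in> ends G e}"] by auto
    qed
    then have "leafless G (edges G)" by (simp add: leafless_def)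
    moreover have "\<exists>x\<in>verts G. \<exists>y\<in>verts G. f x = 0 \<and> f y = 1 \<and> adj G x y"
      using large_degree(2) assms(3) by (simp add: clique_colouring_def)
    then have "edges G \<noteq> {}" by (auto simp: adj_def)
    ultimately show ?case by blast
  qed
qed

text \<open>Edges inside a class inherit its colour, and edges between two classes are given to the winner in a
tournament. For connectedness of the edge classes it is enough that the vertex classes are connected,
because every edge of colour \<open>i\<close> has an end in class \<open>i\<close>. The adjacency of two classes requires that
every vertex has an edge of its own colour. For a class that is a single vertex this means that its
colour wins against some other; such a tournament exists because of \<open>t \<ge> 3\<close>.\<close>

lemma edge_colouring_of_vertex_colouring:
  assumes g: "graph G" and col: "clique_colouring (adj G) (verts G) t f"
    and below: "\<forall>x\<in>verts G. f x < t" and t: "t \<ge> 3"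
  shows "\<exists>c. clique_colouring (meets G) (edges G) t c"
proof -
  \<comment> \<open>The smaller colour wins, except that \<open>t - 1\<close> beats \<open>0\<close>; so \<open>i\<close> beats \<open>i + 1\<close>
    cyclically, which for \<open>t \<ge> 3\<close> is consistent.\<close>
  define win where "win i j = (if i = 0 \<and> j = t - 1 \<or> i = t - 1 \<and> j = 0 then t - 1 else min i j)"
    for i j :: nat
  have win_sym: "win i j = win j i" and win_in: "win i j = i \<or> win i j = j" and win_same: "win i i = i"
    for i j
    using t by (auto simp: win_def min_def)
  have beats: "\<exists>j<t. j \<noteq> i \<and> win i j = i" if "i < t" for i
  proof (cases "i = t - 1")
    case True
    then show ?thesis using t by (intro exI[of _ 0]) (auto simp: win_def)
  next
    case False
    then show ?thesis using t that by (intro exI[of _ "Suc i"]) (auto simp: win_def)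
  qed
  define c where "c e = (THE k. \<exists>x y. ends G e = {x, y} \<and> k = win (f x) (f y))" for e
  have c: "c e = win (f x) (f y)" if "ends G e = {x, y}" for e x y
    unfolding c_def
  proof (rule the_equality)
    show "k = win (f x) (f y)" if "\<exists>x y. ends G e = {x, y} \<and> k = win (f x) (f y)" for k
      using that \<open>ends G e = {x, y}\<close> win_sym by (auto simp: doubleton_eq_iff)
  qed (use that in blast)
  have own: "\<exists>e\<in>edges G. v \<in> ends G e \<and> c e = f v" if v: "v \<in> verts G" for v
  proof (cases rule: class_neighbour_or_spokes[OF col v below[rule_format, OF v], case_names neighbour spokes])
    case (neighbour u)
    then obtain e where "e \<in> edges G" "ends G e = {v, u}" by (auto simp: adj_def)
    then show ?thesis using c[of e v u] neighbour(2) win_same by auto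
  next
    case spokes
    obtain j where j: "j < t" "j \<noteq> f v" "win (f v) j = f v"
      using beats below v by blast
    then obtain y e where "f y = j" "e \<in> edges G" "ends G e = {v, y}"
      using spokes by (meson adj_def)
    then show ?thesis using c[of e v y] j by auto
  qed
  have touches: "\<exists>x\<in>ends G e. x \<in> verts G \<and> f x = c e" if "e \<in> edges G" for e
    using graph_endsE[OF g that] c win_in by (metis insertCI)
  \<comment> \<open>A vertex path in a class turns into a path of edges of that colour, which starts and ends
    with any given edges of the colour at its two ends.\<close>
  have reach: "\<forall>e e'. e \<in> edges G \<longrightarrow> e' \<in> edges G \<longrightarrow> c e = i \<longrightarrow> c e' = i \<longrightarrow> x \<in> ends G e \<longrightarrow> y \<in> ends G e' \<longrightarrow>
      (step_in (meets G) {e \<in> edges G. c e = i})\<^sup>*\<^sup>* e e'"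
    if "(step_in (adj G) {x \<in> verts G. f x = i})\<^sup>*\<^sup>* x y" for i x y
    using that
  proof (induction rule: rtranclp_induct)
    case base
    have "step_in (meets G) {e \<in> edges G. c e = i} e e'"
      if "e \<in> edges G" "e' \<in> edges G" "c e = i" "c e' = i" "x \<in> ends G e" "x \<in> ends G e'" for e e'
      using that by (auto simp: step_in_def meets_def)
    then show ?case by blast
  next
    case (step y z)
    then obtain h where h: "h \<in> edges G" "ends G h = {y, z}" "f y = i" "f z = i"
      by (auto simp: step_in_def adj_def)
    then have ch: "c h = i" using c[of h y z] win_same by simp
    show ?case
    proof (intro allI impI)
      fix e e' assume e: "e \<in> edges G" "e' \<in> edges G" "c e = i" "c e' = i" "x \<in> ends G e" "z \<in> ends G e'"
      then have "(step_in (meets G) {e \<in> edges G. c e = i})\<^sup>*\<^sup>* e h"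
        using step.IH h ch by blast
      moreover have "step_in (meets G) {e \<in> edges G. c e = i} h e'"
        using e h ch by (auto simp: step_in_def meets_def)
      ultimately show "(step_in (meets G) {e \<in> edges G. c e = i})\<^sup>*\<^sup>* e e'"
        by (rule rtranclp.rtrancl_into_rtrancl)
    qed
  qed
  have "clique_colouring (meets G) (edges G) t c"
    unfolding clique_colouring_def
  proof (intro conjI allI impI)
    fix i assume i: "i < t"
    then have "{x \<in> verts G. f x = i} \<noteq> {}" and lk: "linked (adj G) {x \<in> verts G. f x = i}"
      using col by (auto simp: clique_colouring_def)
    then obtain x where "x \<in> verts G" "f x = i" by blast
    then show "{e \<in> edges G. c e = i} \<noteq> {}" using own[of x] by blast
    show "linked (meets G) {e \<in> edges G. c e = i}"
      unfolding linked_def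
    proof (intro ballI)
      fix e e' assume "e \<in> {e \<in> edges G. c e = i}" "e' \<in> {e \<in> edges G. c e = i}"
      then have e: "e \<in> edges G" "c e = i" "e' \<in> edges G" "c e' = i" by auto
      obtain x where x: "x \<in> ends G e" "x \<in> verts G" "f x = i"
        using touches[OF e(1)] e(2) by blast
      obtain y where y: "y \<in> ends G e'" "y \<in> verts G" "f y = i"
        using touches[OF e(3)] e(4) by blast
      have "(step_in (adj G) {x \<in> verts G. f x = i})\<^sup>*\<^sup>* x y"
        using lk x y by (simp add: linked_def)
      then show "(step_in (meets G) {e \<in> edges G. c e = i})\<^sup>*\<^sup>* e e'"
        using reach e x y by blast
    qed
  next
    fix i j assume ij: "i < t" "j < t" "i \<noteq> j"
    then have "\<exists>x\<in>verts G. \<exists>y\<in>verts G. f x = i \<and> f y = j \<and> adj G x y"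
      using col by (simp add: clique_colouring_def)
    then obtain x y h where xy: "x \<in> verts G" "y \<in> verts G" "f x = i" "f y = j"
      and h: "h \<in> edges G" "ends G h = {x, y}"
      by (auto simp: adj_def)
    have "c h = i \<or> c h = j" using c[OF h(2)] xy win_in by simp
    then show "\<exists>e\<in>edges G. \<exists>e'\<in>edges G. c e = i \<and> c e' = j \<and> meets G e e'"
    proof
      assume "c h = i"
      moreover obtain e' where "e' \<in> edges G" "y \<in> ends G e'" "c e' = j"
        using own xy by blast
      ultimately show ?thesis using h by (auto simp: meets_def)
    next
      assume "c h = j"
      moreover obtain e where "e \<in> edges G" "x \<in> ends G e" "c e = i"
        using own xy by blast
      ultimately show ?thesis using h by (auto simp: meets_def)
    qed
  qed
  then show ?thesis by blast
qed

lemma continuable_of_degree: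
  assumes g: "graph G" and deg: "\<forall>x\<in>verts G. 3 \<le> degree G x"
  shows "continuable G (edges G) c"
  unfolding continuable_def
proof (intro ballI)
  fix e x assume e: "e \<in> edges G" "x \<in> ends G e"
  let ?E = "{e \<in> edges G. x \<in> ends G e}"
  have "x \<in> verts G" using e g by (auto simp: graph_def)
  then have three: "3 \<le> card ?E" using deg by (simp add: degree_def)
  obtain f where f: "f \<in> ?E" "f \<noteq> e"
    using card_less_imp_ex_notin[of "{e}" ?E] three by auto
  obtain h where "h \<in> ?E" "h \<noteq> e" "h \<noteq> f"
    using card_less_imp_ex_notin[of "{e, f}" ?E] three f by auto
  then show "\<exists>f\<in>edges G. f \<noteq> e \<and> x \<in> ends G f \<and>
      (c f = c e \<or> (\<exists>g\<in>edges G. g \<noteq> e \<and> g \<noteq> f \<and> x \<in> ends G g))"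
    using f by blast
qed

text \<open>Besides \<open>e\<close>, there is at most one edge \<open>e'\<close> at \<open>v\<close>. If \<open>e'\<close> is among the coloured edges, undoing
the contraction subdivides it into \<open>e\<close> and \<open>e'\<close>, which therefore share its colour. Mapping \<open>e\<close> to
\<open>e'\<close>, the colouring is pulled back. If there is no coloured edge at \<open>v\<close>, nothing changes.\<close>

lemma continuable_edge_colouring_uncontract:
  assumes g: "graph G" and e: "e \<in> edges G" "ends G e = {u, v}" and deg: "degree G v < 3"
    and F: "F \<subseteq> edges (contract G u v)" and cont: "continuable (contract G u v) F c"
    and col: "clique_colouring (meets (contract G u v)) F t c"
  shows "\<exists>F c. F \<subseteq> edges G \<and> continuable G F c \<and> clique_colouring (meets G) F t c"
proof -
  let ?G' = "contract G u v"
  have uv: "u \<noteq> v" using adj_verts[OF g, of u v] e by (auto simp: adj_def)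
  have FG: "F \<subseteq> edges G" and eF: "e \<notin> F" using F e by (auto simp: contract_def)
  have fin: "finite {e \<in> edges G. v \<in> ends G e}" using g by (simp add: graph_def)
  show ?thesis
  proof (cases "\<exists>e'\<in>F. v \<in> ends G e'")
    case False
    then have "\<forall>x\<in>F. ends ?G' x = ends G x" by (auto simp: contract_def)
    then have "continuable G F c" "\<forall>a\<in>F. \<forall>b\<in>F. meets ?G' a b \<longrightarrow> meets G a b"
      using cont by (simp_all add: continuable_def meets_def)
    then show ?thesis using FG clique_colouring_mono[OF col, of "meets G"] by blast
  next
    case True
    then obtain e' where e': "e' \<in> F" "v \<in> ends G e'" by blast
    then have "e' \<in> edges G" "e' \<noteq> e" using FG eF by auto
    obtain w where w: "ends G e' = {v, w}" "w \<noteq> v"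
      using graph_other_endE[OF g \<open>e' \<in> edges G\<close> e'(2)] .
    have "w \<noteq> u" using F e'(1) w by (auto simp: contract_def)
    have ends_e': "ends ?G' e' = {u, w}" using w by (simp add: contract_def insert_commute)
    have ends_eq: "v \<notin> ends G x" "ends ?G' x = ends G x" if "x \<in> F" "x \<noteq> e'" for x
    proof -
      show "v \<notin> ends G x"
        using card_ge_3[OF fin, of x e e'] that FG eF e e' \<open>e' \<noteq> e\<close> deg by (auto simp: degree_def)
      then show "ends ?G' x = ends G x" by (auto simp: contract_def)
    qed
    define h where "h x = (if x = e then e' else x)" for x
    have h_F: "h x \<in> F" if "x \<in> insert e F" for x using that e' by (auto simp: h_def)
    have h_id: "h x = x" if "x \<in> F" for x using that eF by (auto simp: h_def)
    have h_e: "h e = e'" by (simp add: h_def)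
    \<comment> \<open>An incidence of \<open>contract G u v\<close> away from \<open>v\<close> comes from one of \<open>G\<close>; the end \<open>u\<close> of
      \<open>e'\<close> comes from the end \<open>u\<close> of \<open>e\<close>.\<close>
    have lift: "\<exists>z\<in>insert e F. h z = z' \<and> x \<in> ends G z" if "z' \<in> F" "x \<in> ends ?G' z'" for z' x
    proof (cases "z' = e'")
      case True
      then have "x = u \<or> x = w" using that ends_e' by simp
      then show ?thesis
      proof
        assume "x = u"
        then show ?thesis using True e(2) h_e by (intro bexI[of _ e]) auto
      next
        assume "x = w"
        then show ?thesis using True e'(1) w(1) h_id by (intro bexI[of _ e']) auto
      qed
    next
      case False
      then show ?thesis using that ends_eq h_id by auto
    qed
    have lower: "x \<in> ends ?G' (h z)" if "z \<in> insert e F" "x \<in> ends G z" "x \<noteq> v" for z x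
    proof (cases "z = e \<or> z = e'")
      case True
      then show ?thesis using that ends_e' e w e'(1) h_e h_id by auto
    next
      case False
      then show ?thesis using that ends_eq h_id by auto
    qed
    have "continuable G (insert e F) (c \<circ> h)"
      unfolding continuable_def
    proof (intro ballI)
      fix x y assume x: "x \<in> insert e F" "y \<in> ends G x"
      show "\<exists>z\<in>insert e F. z \<noteq> x \<and> y \<in> ends G z \<and> ((c \<circ> h) z = (c \<circ> h) x \<or>
              (\<exists>q\<in>insert e F. q \<noteq> x \<and> q \<noteq> z \<and> y \<in> ends G q))"
      proof (cases "y = v")
        case True
        then have "x = e \<or> x = e'" using x ends_eq by blast
        moreover have "(c \<circ> h) e = (c \<circ> h) e'" using h_e h_id[OF e'(1)] by simp
        ultimately show ?thesis
          using True e(2) e' \<open>e' \<noteq> e\<close> by (metis insertCI)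
      next
        case False
        then obtain z' where z': "z' \<in> F" "z' \<noteq> h x" "y \<in> ends ?G' z'"
            and or: "c z' = c (h x) \<or> (\<exists>q'\<in>F. q' \<noteq> h x \<and> q' \<noteq> z' \<and> y \<in> ends ?G' q')"
          using cont h_F[OF x(1)] lower[OF x] unfolding continuable_def by blast
        obtain z where z: "z \<in> insert e F" "h z = z'" "y \<in> ends G z"
          using lift z' by blast
        from or show ?thesis
        proof
          assume "c z' = c (h x)"
          then show ?thesis using z z' by auto
        next
          assume "\<exists>q'\<in>F. q' \<noteq> h x \<and> q' \<noteq> z' \<and> y \<in> ends ?G' q'"
          then obtain q' where q': "q' \<in> F" "q' \<noteq> h x" "q' \<noteq> z'" "y \<in> ends ?G' q'" by blast
          then obtain q where q: "q \<in> insert e F" "h q = q'" "y \<in> ends G q"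
            using lift by blast
          have "z \<noteq> x" "q \<noteq> x" "q \<noteq> z" using z(2) z'(2) q(2) q'(2,3) by auto
          then show ?thesis using z(1,3) q(1,3) by blast
        qed
      qed
    qed
    moreover have "clique_colouring (meets G) (insert e F) t (c \<circ> h)"
    proof (rule clique_colouring_preimage[OF col])
      show "h ` insert e F = F" using h_F h_id by (force simp: image_iff)
    next
      fix a b assume ab: "a \<in> insert e F" "b \<in> insert e F" "c (h a) = c (h b)"
        and "h a = h b \<or> meets ?G' (h a) (h b)"
      let ?C = "{x \<in> insert e F. c (h x) = c (h a)}"
      let ?R = "step_in (meets G) ?C"
      have same: "?R\<^sup>*\<^sup>* x y" if "x \<in> ?C" "y \<in> ?C" "h x = h y" for x y
      proof (cases "x = y")
        case False
        then have "{x, y} = {e, e'}"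
          using that(3) by (auto simp: h_def split: if_splits)
        then have "meets G x y" using e e' by (auto simp: meets_def doubleton_eq_iff)
        then show ?thesis using that by (intro r_into_rtranclp) (simp add: step_in_def)
      qed simp
      from \<open>h a = h b \<or> meets ?G' (h a) (h b)\<close> show "?R\<^sup>*\<^sup>* a b"
      proof
        assume "h a = h b"
        then show ?thesis using same ab by simp
      next
        assume "meets ?G' (h a) (h b)"
        then obtain x where "x \<in> ends ?G' (h a)" "x \<in> ends ?G' (h b)"
          by (auto simp: meets_def)
        then obtain p q where p: "p \<in> insert e F" "h p = h a" "x \<in> ends G p"
          and q: "q \<in> insert e F" "h q = h b" "x \<in> ends G q"
          using lift h_F ab by metis
        then have "?R p q" using ab by (auto simp: step_in_def meets_def)
        moreover have "?R\<^sup>*\<^sup>* a p" "?R\<^sup>*\<^sup>* q b" using same p q ab by simp_all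
        ultimately show ?thesis by (meson converse_rtranclp_into_rtranclp rtranclp_trans)
      qed
    next
      fix a b assume "a \<in> F" "b \<in> F" "meets ?G' a b"
      then obtain x where x: "x \<in> ends ?G' a" "x \<in> ends ?G' b" by (auto simp: meets_def)
      obtain p q where "p \<in> insert e F" "h p = a" "x \<in> ends G p" "q \<in> insert e F" "h q = b" "x \<in> ends G q"
        using lift[OF \<open>a \<in> F\<close> x(1)] lift[OF \<open>b \<in> F\<close> x(2)] by blast
      moreover from this have "meets G p q" by (auto simp: meets_def)
      ultimately show "\<exists>p\<in>insert e F. \<exists>q\<in>insert e F. h p = a \<and> h q = b \<and> meets G p q"
        by blast
    qed
    ultimately show ?thesis using FG e(1) by blast
  qed
qed

lemma continuable_edge_colouring:
  assumes "graph G" and "clique_colouring (adj G) (verts G) t f" and "t \<ge> 4"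
  shows "\<exists>F c. F \<subseteq> edges G \<and> continuable G F c \<and> clique_colouring (meets G) F t c"
proof -
  have "3 < t" using assms(3) by simp
  from assms(1,2) this show ?thesis
  proof (induction rule: clique_colouring_reduction)
    case (subgraph H G)
    then obtain F c where F: "F \<subseteq> edges H" "continuable H F c" "clique_colouring (meets H) F t c" by blast
    then have "\<forall>e\<in>F. ends H e = ends G e" "F \<subseteq> edges G"
      using subgraph by (auto simp: subgraph_def)
    moreover from this have "continuable G F c"
      using F(2) by (simp add: continuable_def)
    moreover have "clique_colouring (meets G) F t c"
      by (rule clique_colouring_mono[OF F(3)]) (use calculation in \<open>simp add: meets_def\<close>)
    ultimately show ?case by blast
  next
    case (contract G e u v)
    then show ?case using continuable_edge_colouring_uncontract[of G e u v] by blast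
  next
    case (large_degree G f)
    then show ?case
      using edge_colouring_of_vertex_colouring[of G t f] continuable_of_degree[of G] assms(3) by fastforce
  qed
qed

text \<open>Edges with a common end are pairwise incident, so single edges serve as classes.\<close>

lemma star_edge_colouring:
  assumes g: "graph G" and d: "d \<le> degree G v"
  shows "\<exists>c. clique_colouring (meets G) (edges G) d c"
proof -
  let ?E = "{e \<in> edges G. v \<in> ends G e}"
  have fin: "finite ?E" using g by (simp add: graph_def)
  obtain b where b: "bij_betw b ?E {0..<card ?E}"
    using ex_bij_betw_finite_nat[OF fin] by blast
  define c where "c e = (if e \<in> ?E then b e else d)" for e
  have single: "\<exists>e\<in>?E. {e \<in> edges G. c e = i} = {e}" if "i < d" for i
  proof -
    have "i \<in> b ` ?E"
      unfolding bij_betw_imp_surj_on[OF b] using that d by (simp add: degree_def)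
    then obtain e where e: "e \<in> ?E" "b e = i" by blast
    have "x = e" if "x \<in> edges G" "c x = i" for x
      using that e b \<open>i < d\<close> unfolding c_def bij_betw_def
      by (metis (no_types, lifting) inj_on_def less_irrefl)
    then have "{x \<in> edges G. c x = i} = {e}" using e \<open>i < d\<close> by (auto simp: c_def)
    then show ?thesis using e by blast
  qed
  have "clique_colouring (meets G) (edges G) d c"
    unfolding clique_colouring_def
  proof (intro conjI allI impI)
    fix i assume "i < d"
    then obtain e where e: "{e \<in> edges G. c e = i} = {e}" using single by blast
    show "{e \<in> edges G. c e = i} \<noteq> {}" "linked (meets G) {e \<in> edges G. c e = i}"
      unfolding e by (simp_all add: linked_def)
  next
    fix i j assume "i < d" "j < d"
    obtain e e' where "e \<in> ?E" "{e \<in> edges G. c e = i} = {e}" "e' \<in> ?E" "{e \<in> edges G. c e = j} = {e'}"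
      using single[OF \<open>i < d\<close>] single[OF \<open>j < d\<close>] by blast
    then show "\<exists>e\<in>edges G. \<exists>e'\<in>edges G. c e = i \<and> c e' = j \<and> meets G e e'"
      unfolding meets_def by blast
  qed
  then show ?thesis by blast
qed


section \<open>Colourings of walks that climb from one length to the next\<close>

text \<open>The induction on the length of walks uses only oriented edges \<open>D\<close>, their reversal \<open>flip\<close>, and
the relation \<open>step\<close> of continuing one with another.\<close>

locale reversible_steps =
  fixes D :: "'d set" and flip :: "'d \<Rightarrow> 'd" and step :: "'d \<Rightarrow> 'd \<Rightarrow> bool"
  assumes flip_in: "d \<in> D \<Longrightarrow> flip d \<in> D"
    and flip_flip: "d \<in> D \<Longrightarrow> flip (flip d) = d"
    and step_flip: "d \<in> D \<Longrightarrow> d' \<in> D \<Longrightarrow> step d d' \<Longrightarrow> step (flip d') (flip d)"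
begin

definition walks :: "nat \<Rightarrow> 'd list set" where
  "walks n = {A. length A = n \<and> set A \<subseteq> D \<and> successively step A}"

definition reversal :: "'d list \<Rightarrow> 'd list" where
  "reversal A = map flip (rev A)"

definition shift :: "'d list \<Rightarrow> 'd list \<Rightarrow> bool" where
  "shift A B \<longleftrightarrow> (\<exists>Q\<in>walks (Suc (length A)). A = butlast Q \<and> B = tl Q)"

text \<open>Walks are lists, so a walk and its reversal are different. Declaring them adjacent has the effect of
identifying them, because they will always have the same colour.\<close>

definition neighbour :: "'d list \<Rightarrow> 'd list \<Rightarrow> bool" where
  "neighbour A B \<longleftrightarrow> B = reversal A \<or> shift A B \<or> shift B A"

lemma shift_iff:
  "A \<in> walks n \<Longrightarrow> shift A B \<longleftrightarrow> (\<exists>Q\<in>walks (Suc n). A = butlast Q \<and> B = tl Q)"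
  by (simp add: shift_def walks_def)

lemma reversal_reversal: "A \<in> walks n \<Longrightarrow> reversal (reversal A) = A"
  by (auto simp: walks_def reversal_def rev_map flip_flip intro!: map_idI)

lemma reversal_walks:
  assumes "A \<in> walks n" shows "reversal A \<in> walks n"
proof -
  have "successively step (map flip (rev A))" if "set A \<subseteq> D" "successively step A" for A
    using that
  proof (induction A)
    case (Cons d A)
    then show ?case
      by (cases A) (auto simp: successively_append_iff step_flip)
  qed simp
  then show ?thesis
    using assms flip_in by (auto simp: walks_def reversal_def)
qed

lemma reversal_snoc: "reversal (A @ [d]) = flip d # reversal A"
  and reversal_Cons: "reversal (d # A) = reversal A @ [flip d]"
  by (simp_all add: reversal_def)

lemma reversal_butlast: "reversal (butlast A) = tl (reversal A)"
  by (cases A rule: rev_cases) (simp_all add: reversal_def)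

lemma reversal_tl: "reversal (tl A) = butlast (reversal A)"
  by (cases A) (simp_all add: reversal_def)

lemma walks_snocD: "A @ [d] \<in> walks (Suc n) \<Longrightarrow> A \<in> walks n"
  and walks_ConsD: "d # A \<in> walks (Suc n) \<Longrightarrow> A \<in> walks n"
  by (auto simp: walks_def successively_append_iff successively_Cons)

lemma walks_glue:
  assumes "d # A \<in> walks (Suc n)" "A @ [d'] \<in> walks (Suc n)" "n > 0"
  shows "d # A @ [d'] \<in> walks (Suc (Suc n))"
  using assms by (cases A) (auto simp: walks_def)

lemma walks_Suc_cases:
  assumes "Q \<in> walks (Suc n)" "n > 0"
  obtains d A d' where "Q = d # A @ [d']" "d # A \<in> walks n" "A @ [d'] \<in> walks n"
proof -
  obtain d R where R: "Q = d # R" "R \<noteq> []"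
    using assms by (cases Q) (auto simp: walks_def)
  then obtain A d' where "R = A @ [d']" by (cases R rule: rev_cases) auto
  with R have Q: "Q = d # A @ [d']" by simp
  show ?thesis
  proof (rule that)
    show "d # A \<in> walks n"
      using walks_snocD[of "d # A" d' n] assms Q by simp
    show "A @ [d'] \<in> walks n"
      using walks_ConsD[of d "A @ [d']" n] assms Q by simp
  qed (rule Q)
qed

text \<open>Here \<open>f\<close> colours walks of length \<open>n\<close>, and \<open>g\<close> those of length \<open>n + 1\<close>: a longer
walk takes the colour of one of its two parts, and no shorter walk is cut off from its own colour at
its right end. By invariance under reversal the same holds at its left end.\<close>

definition supports :: "nat \<Rightarrow> ('d list \<Rightarrow> nat) \<Rightarrow> ('d list \<Rightarrow> nat) \<Rightarrow> bool" where
  "supports n f g \<longleftrightarrow>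
     (\<forall>A\<in>walks n. f (reversal A) = f A) \<and>
     (\<forall>Q\<in>walks (Suc n). g (reversal Q) = g Q \<and> g Q \<in> {f (butlast Q), f (tl Q)}) \<and>
     (\<forall>A\<in>walks n. \<exists>d. A @ [d] \<in> walks (Suc n) \<and> g (A @ [d]) = f A)"

lemma supports_right:
  assumes "supports n f g" "A \<in> walks n"
  obtains d where "A @ [d] \<in> walks (Suc n)" "g (A @ [d]) = f A"
  using assms unfolding supports_def by blast

lemma supports_left:
  assumes "supports n f g" "A \<in> walks n"
  obtains d where "d # A \<in> walks (Suc n)" "g (d # A) = f A"
proof -
  obtain d where d: "reversal A @ [d] \<in> walks (Suc n)" "g (reversal A @ [d]) = f (reversal A)"
    using supports_right[OF assms(1) reversal_walks[OF assms(2)]] .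
  have "reversal (reversal A @ [d]) = flip d # A"
    using assms(2) by (simp add: reversal_snoc reversal_reversal)
  moreover have "g (reversal (reversal A @ [d])) = g (reversal A @ [d])" "f (reversal A) = f A"
    using assms d(1) unfolding supports_def by blast+
  ultimately show ?thesis
    using that[of "flip d"] d reversal_walks[OF d(1)] by simp
qed

text \<open>Consider the walks \<open>d A d'\<close> with a fixed middle part \<open>A\<close> of length \<open>n\<close>. The walk \<open>A\<close> has
a right extension by \<open>\<sigma> A\<close> and a left extension by \<open>\<tau> A\<close>, both of its own colour. All
\<open>d A\<close> are satisfied by \<open>d' = \<sigma> A\<close> and all \<open>A d'\<close> by \<open>d = \<tau> A\<close>; if both equations
hold, the two parts have the colour of \<open>A\<close>, and there is no conflict. The minimum in the remaining
case is an arbitrary choice that is invariant under reversal.\<close>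

lemma supports_Suc:
  assumes fg: "supports n f g" and n: "n > 0"
  shows "\<exists>h. supports (Suc n) g h"
proof -
  define \<sigma> where "\<sigma> A = (SOME d. A @ [d] \<in> walks (Suc n) \<and> g (A @ [d]) = f A)" for A
  have \<sigma>: "A @ [\<sigma> A] \<in> walks (Suc n)" "g (A @ [\<sigma> A]) = f A" "\<sigma> A \<in> D" if "A \<in> walks n" for A
  proof -
    have "\<exists>d. A @ [d] \<in> walks (Suc n) \<and> g (A @ [d]) = f A"
      using supports_right[OF fg that] by metis
    then have "A @ [\<sigma> A] \<in> walks (Suc n) \<and> g (A @ [\<sigma> A]) = f A"
      unfolding \<sigma>_def by (rule someI_ex)
    then show "A @ [\<sigma> A] \<in> walks (Suc n)" "g (A @ [\<sigma> A]) = f A" by simp_all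
    then show "\<sigma> A \<in> D" by (simp add: walks_def)
  qed
  define \<tau> where "\<tau> A = flip (\<sigma> (reversal A))" for A
  have f_rev: "f (reversal A) = f A" if "A \<in> walks n" for A
    using fg that by (simp add: supports_def)
  have g_rev: "g (reversal Q) = g Q" if "Q \<in> walks (Suc n)" for Q
    using fg that by (simp add: supports_def)
  have \<tau>: "\<tau> A # A \<in> walks (Suc n)" "g (\<tau> A # A) = f A" "\<tau> A \<in> D" if "A \<in> walks n" for A
  proof -
    let ?Q = "reversal A @ [\<sigma> (reversal A)]"
    have "?Q \<in> walks (Suc n)" "g ?Q = f A"
      using \<sigma>[OF reversal_walks[OF that]] f_rev[OF that] by simp_all
    moreover have "reversal ?Q = \<tau> A # A"
      using that by (simp add: reversal_snoc reversal_reversal \<tau>_def)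
    ultimately show "\<tau> A # A \<in> walks (Suc n)" "g (\<tau> A # A) = f A"
      using reversal_walks g_rev by metis+
    then show "\<tau> A \<in> D" by (simp add: walks_def)
  qed
  define h where "h Q = (let A = butlast (tl Q) in
      if last Q = \<sigma> A then g (butlast Q) else if hd Q = \<tau> A then g (tl Q)
      else min (g (butlast Q)) (g (tl Q)))" for Q
  have h: "h (d # A @ [d']) = (if d' = \<sigma> A then g (d # A) else if d = \<tau> A then g (A @ [d'])
      else min (g (d # A)) (g (A @ [d'])))" for d d' A
    by (simp add: h_def Let_def butlast_append)
  have h_rev: "h (reversal Q) = h Q" if Q: "Q \<in> walks (Suc (Suc n))" for Q
  proof -
    obtain d A d' where Q_eq: "Q = d # A @ [d']" and dA: "d # A \<in> walks (Suc n)"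
      and Ad': "A @ [d'] \<in> walks (Suc n)"
      using walks_Suc_cases[OF Q] by blast
    then have A: "A \<in> walks n" and D: "d \<in> D" "d' \<in> D"
      using walks_ConsD by (auto simp: walks_def)
    have "reversal Q = flip d' # reversal A @ [flip d]"
      by (simp add: Q_eq reversal_def)
    moreover have "flip d = \<sigma> (reversal A) \<longleftrightarrow> d = \<tau> A"
      using D(1) \<sigma>(3)[OF reversal_walks[OF A]] flip_flip unfolding \<tau>_def by metis
    moreover have "flip d' = \<tau> (reversal A) \<longleftrightarrow> d' = \<sigma> A"
      using D(2) \<sigma>(3)[OF A] flip_flip unfolding \<tau>_def reversal_reversal[OF A] by metis
    moreover have "g (flip d' # reversal A) = g (A @ [d'])" "g (reversal A @ [flip d]) = g (d # A)"
      using g_rev[OF Ad'] g_rev[OF dA] by (simp_all add: reversal_snoc reversal_Cons)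
    moreover have "g (d # A) = g (A @ [d'])" if "d = \<tau> A" "d' = \<sigma> A"
      using that \<sigma>[OF A] \<tau>[OF A] by simp
    ultimately show ?thesis
      unfolding Q_eq h by (auto simp: h)
  qed
  have "\<exists>d. Q @ [d] \<in> walks (Suc (Suc n)) \<and> h (Q @ [d]) = g Q" if QW: "Q \<in> walks (Suc n)" for Q
  proof -
    obtain d A where Q: "Q = d # A"
      using QW by (cases Q) (simp_all add: walks_def)
    then have A: "A \<in> walks n"
      using that walks_ConsD by blast
    have "Q @ [\<sigma> A] \<in> walks (Suc (Suc n))"
      using walks_glue[of d A n "\<sigma> A"] that \<sigma>(1)[OF A] n by (simp add: Q)
    moreover have "h (Q @ [\<sigma> A]) = g Q" by (simp add: Q h)
    ultimately show ?thesis by blast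
  qed
  moreover have "h Q \<in> {g (butlast Q), g (tl Q)}" for Q
    by (auto simp: h_def Let_def min_def)
  ultimately have "supports (Suc n) g h"
    using g_rev h_rev by (simp add: supports_def)
  then show ?thesis by blast
qed

lemma neighbour_sym: "A \<in> walks n \<Longrightarrow> neighbour A B \<Longrightarrow> neighbour B A"
  using reversal_reversal by (auto simp: neighbour_def)

text \<open>A walk of length \<open>n\<close> is replaced by the bundle of its extensions of the same colour. Every bundle is
connected: it has extensions on both sides, and any left extension is a shift of any right extension.
Adjacent walks of the same colour have bundles with a common member, namely the walk of which both
are parts. Finally, if \<open>Q\<close> joins walks of colours \<open>i\<close> and \<open>j\<close>, it has one of these
colours itself, say that of its first part; then prolonging its second part beyond \<open>Q\<close> within colour
\<open>j\<close> gives a neighbour of \<open>Q\<close>.\<close>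

lemma clique_colouring_Suc:
  assumes fg: "supports n f g" and n: "n > 0"
    and col: "clique_colouring neighbour (walks n) t f"
  shows "clique_colouring neighbour (walks (Suc n)) t g"
proof -
  define W where "W i = {Q \<in> walks (Suc n). g Q = i}" for i
  define R where "R i = (step_in neighbour (W i))\<^sup>*\<^sup>*" for i
  have R_rev: "R i Q (reversal Q)" "R i (reversal Q) Q" if "Q \<in> W i" for i Q
  proof -
    have "reversal Q \<in> W i" using that fg reversal_walks by (simp add: W_def supports_def)
    moreover have "neighbour Q (reversal Q)" "neighbour (reversal Q) Q"
      using that neighbour_sym by (auto simp: neighbour_def W_def reversal_reversal)
    ultimately show "R i Q (reversal Q)" "R i (reversal Q) Q"
      using that unfolding R_def by (auto intro!: r_into_rtranclp simp: step_in_def)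
  qed
  have R_trans: "R i P S" if "R i P Q" "R i Q S" for i P Q S
    using that unfolding R_def by (rule rtranclp_trans)
  have glue: "R i (d # A) (A @ [d'])" "R i (A @ [d']) (d # A)"
    if "d # A \<in> W i" "A @ [d'] \<in> W i" for i d A d'
  proof -
    have "d # A @ [d'] \<in> walks (Suc (Suc n))"
      using walks_glue that n by (simp add: W_def)
    moreover have "length (d # A) = Suc n" using that by (simp add: W_def walks_def)
    ultimately have "shift (d # A) (A @ [d'])"
      unfolding shift_def by (metis butlast_snoc append_Cons list.sel(3))
    then show "R i (d # A) (A @ [d'])" "R i (A @ [d']) (d # A)"
      using that unfolding R_def
      by (auto intro!: r_into_rtranclp simp: step_in_def neighbour_def)
  qed
  \<comment> \<open>\<open>around A Q\<close>: up to reversal, \<open>A\<close> is one of the two parts of \<open>Q\<close>.\<close>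
  define around where "around A Q \<longleftrightarrow> A \<in> {butlast Q, tl Q, reversal (butlast Q), reversal (tl Q)}" for A Q
  have to_right: "R i Q (A @ [d']) \<and> R i (A @ [d']) Q"
    if A: "A \<in> walks n" "f A = i" and Q: "Q \<in> W i" "around A Q"
      and d': "A @ [d'] \<in> W i" for A i Q d'
  proof -
    obtain d where d: "d # A \<in> W i"
      using supports_left[OF fg A(1)] A(2) by (auto simp: W_def)
    have *: "R i P (A @ [d']) \<and> R i (A @ [d']) P" if P: "P \<in> W i" "A = butlast P \<or> A = tl P" for P
    proof (cases "A = butlast P")
      case True
      then obtain x where x: "P = A @ [x]"
        using P by (cases P rule: rev_cases) (auto simp: W_def walks_def)
      then show ?thesis using glue[OF d] P d' R_trans by blast
    next
      case False
      then obtain x where "P = x # A"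
        using P by (cases P) (auto simp: W_def walks_def)
      then show ?thesis using glue P d' by blast
    qed
    show ?thesis
    proof (cases "A = butlast Q \<or> A = tl Q")
      case False
      then have "A = butlast (reversal Q) \<or> A = tl (reversal Q)"
        using Q(2) by (auto simp: around_def reversal_butlast reversal_tl)
      moreover have "reversal Q \<in> W i"
        using Q fg reversal_walks by (simp add: W_def supports_def)
      ultimately show ?thesis using * R_rev[OF Q(1)] R_trans by blast
    qed (use * Q in blast)
  qed
  have meet: "R i P Q" if A: "A \<in> walks n" "f A = i" and "P \<in> W i" "Q \<in> W i" "around A P" "around A Q" for A i P Q
  proof -
    obtain d where "A @ [d] \<in> W i"
      using supports_right[OF fg A(1)] A(2) by (auto simp: W_def)
    then show ?thesis using to_right A that R_trans by blast
  qed
  have chain: "\<forall>P\<in>W i. \<forall>Q\<in>W i. around A P \<longrightarrow> around B Q \<longrightarrow> R i P Q"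
    if "(step_in neighbour {A \<in> walks n. f A = i})\<^sup>*\<^sup>* A B" "A \<in> walks n" "f A = i" for i A B
    using that(1)
  proof (induction rule: rtranclp_induct)
    case base
    then show ?case using meet that by blast
  next
    case (step B C)
    then have BC: "B \<in> walks n" "C \<in> walks n" "f B = i" "f C = i" "neighbour B C"
      by (auto simp: step_in_def)
    \<comment> \<open>If \<open>B\<close> and \<open>C\<close> are the two parts of \<open>S\<close>, both have colour \<open>i\<close>, hence \<open>S\<close> too.\<close>
    have "\<exists>S\<in>W i. around B S \<and> around C S"
    proof (cases "C = reversal B")
      case True
      obtain d where d: "B @ [d] \<in> walks (Suc n)" "g (B @ [d]) = f B"
        using supports_right[OF fg BC(1)] .
      then have "B @ [d] \<in> W i" "around B (B @ [d])" "around C (B @ [d])"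
        using BC True by (auto simp: W_def around_def)
      then show ?thesis by blast
    next
      case False
      then have "shift B C \<or> shift C B"
        using BC(5) by (simp add: neighbour_def)
      then obtain S where S: "S \<in> walks (Suc n)"
          "B = butlast S \<and> C = tl S \<or> C = butlast S \<and> B = tl S"
        unfolding shift_iff[OF BC(1)] shift_iff[OF BC(2)] by blast
      then have "g S \<in> {f B, f C}"
        using fg unfolding supports_def by blast
      then have "S \<in> W i" using S BC by (auto simp: W_def)
      moreover have "around B S" "around C S"
        using S(2) by (auto simp: around_def)
      ultimately show ?thesis by blast
    qed
    then obtain S where S: "S \<in> W i" "around B S" "around C S" by blast
    show ?case
    proof (intro ballI impI)
      fix P Q assume "P \<in> W i" "Q \<in> W i" "around A P" "around C Q"
      then show "R i P Q"
        using step.IH S meet[OF BC(2,4) S(1)] R_trans by blast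
    qed
  qed
  have below: "\<exists>A\<in>walks n. f A = i \<and> around A Q" if "Q \<in> W i" for i Q
  proof -
    have Q: "Q \<in> walks (Suc n)" "g Q = i" using that by (auto simp: W_def)
    then obtain d A d' where "Q = d # A @ [d']" "d # A \<in> walks n" "A @ [d'] \<in> walks n"
      using walks_Suc_cases n by metis
    then have "butlast Q \<in> walks n" "tl Q \<in> walks n" by (auto simp: butlast_append)
    moreover have "g Q \<in> {f (butlast Q), f (tl Q)}"
      using fg Q(1) by (simp add: supports_def)
    ultimately show ?thesis using Q(2) unfolding around_def by auto
  qed
  show ?thesis
    unfolding clique_colouring_def
  proof (intro conjI allI impI)
    fix i assume i: "i < t"
    then obtain A where "A \<in> walks n" "f A = i"
      using col unfolding clique_colouring_def by blast
    then obtain d where "A @ [d] \<in> walks (Suc n)" "g (A @ [d]) = i"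
      using supports_right[OF fg] by metis
    then show "{Q \<in> walks (Suc n). g Q = i} \<noteq> {}" by blast
    have "(step_in neighbour (W i))\<^sup>*\<^sup>* P Q" if PQ: "P \<in> W i" "Q \<in> W i" for P Q
    proof -
      obtain A B where "A \<in> walks n" "f A = i" "around A P" "B \<in> walks n" "f B = i" "around B Q"
        using below[OF PQ(1)] below[OF PQ(2)] by blast
      moreover from this have "(step_in neighbour {A \<in> walks n. f A = i})\<^sup>*\<^sup>* A B"
        using col i by (simp add: clique_colouring_def linked_def)
      ultimately show ?thesis
        using chain that unfolding R_def by blast
    qed
    then show "linked neighbour {Q \<in> walks (Suc n). g Q = i}"
      by (simp add: linked_def W_def)
  next
    fix i j assume ij: "i < t" "j < t" "i \<noteq> j"
    then obtain A B where AB: "A \<in> walks n" "B \<in> walks n" "f A = i" "f B = j" "neighbour A B"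
      using col unfolding clique_colouring_def by blast
    then have "B \<noteq> reversal A"
      using fg ij by (auto simp: supports_def)
    with AB consider "shift A B" | "shift B A" by (auto simp: neighbour_def)
    then have "\<exists>Q\<in>walks (Suc n). f (butlast Q) = i \<and> f (tl Q) = j"
    proof cases
      case 1
      then show ?thesis using AB by (auto simp: shift_def walks_def)
    next
      case 2
      then obtain Q where "Q \<in> walks (Suc n)" "B = butlast Q" "A = tl Q"
        using AB by (auto simp: shift_def walks_def)
      moreover have "f (reversal A) = i" "f (reversal B) = j"
        using fg AB by (auto simp: supports_def)
      ultimately show ?thesis
        using reversal_walks by (intro bexI[of _ "reversal Q"])
          (auto simp: reversal_butlast[symmetric] reversal_tl[symmetric])
    qed
    then obtain Q where Q: "Q \<in> walks (Suc n)" "f (butlast Q) = i" "f (tl Q) = j" by blast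
    then obtain d C d' where Qd: "Q = d # C @ [d']" "d # C \<in> walks n" "C @ [d'] \<in> walks n"
      using walks_Suc_cases n by metis
    have fd: "f (d # C) = i" "f (C @ [d']) = j" using Q by (simp_all add: Qd butlast_append)
    have "g Q = i \<or> g Q = j"
      using fg Q unfolding supports_def by blast
    then have "\<exists>P S. P \<in> walks (Suc n) \<and> S \<in> walks (Suc n) \<and> g P = i \<and> g S = j \<and> shift P S"
    proof
      assume gQ: "g Q = i"
      obtain x where x: "(C @ [d']) @ [x] \<in> walks (Suc n)" "g ((C @ [d']) @ [x]) = j"
        using supports_right[OF fg Qd(3)] fd by metis
      have "d # (C @ [d']) @ [x] \<in> walks (Suc (Suc n))"
        using walks_glue[of d "C @ [d']" n x] Q x n by (simp add: Qd)
      then have "shift Q ((C @ [d']) @ [x])"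
        unfolding shift_def using Q(1)
        by (intro bexI[of _ "d # (C @ [d']) @ [x]"]) (auto simp: Qd walks_def butlast_append)
      then show ?thesis using x Q gQ by blast
    next
      assume gQ: "g Q = j"
      obtain x where x: "x # d # C \<in> walks (Suc n)" "g (x # d # C) = i"
        using supports_left[OF fg Qd(2)] fd by metis
      have "x # (d # C) @ [d'] \<in> walks (Suc (Suc n))"
        using walks_glue[of x "d # C" n d'] Q x n by (simp add: Qd)
      then have "shift (x # d # C) Q"
        unfolding shift_def using x(1)
        by (intro bexI[of _ "x # (d # C) @ [d']"]) (auto simp: Qd walks_def butlast_append)
      then show ?thesis using x Q gQ by blast
    qed
    then show "\<exists>P\<in>walks (Suc n). \<exists>S\<in>walks (Suc n). g P = i \<and> g S = j \<and> neighbour P S"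
      unfolding neighbour_def by blast
  qed
qed

lemma clique_colouring_climb:
  assumes "supports (Suc 0) f g" and "clique_colouring neighbour (walks (Suc 0)) t f"
  shows "\<exists>f' g'. supports (Suc n) f' g' \<and> clique_colouring neighbour (walks (Suc n)) t f'"
proof (induction n)
  case 0
  then show ?case using assms by blast
next
  case (Suc n)
  then show ?case
    using supports_Suc clique_colouring_Suc by (metis zero_less_Suc)
qed

end


section \<open>Walks in graphs of large girth\<close>

text \<open>An edge with a direction, as the triple of its tail, the edge, and its head.\<close>

definition darts :: "('v, 'e) mgraph \<Rightarrow> 'e set \<Rightarrow> ('v \<times> 'e \<times> 'v) set" where
  "darts G F = {(x, e, y). e \<in> F \<and> ends G e = {x, y}}"

definition turn :: "'v \<times> 'e \<times> 'v \<Rightarrow> 'v \<times> 'e \<times> 'v" where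
  "turn d = (snd (snd d), fst (snd d), fst d)"

definition follows :: "'v \<times> 'e \<times> 'v \<Rightarrow> 'v \<times> 'e \<times> 'v \<Rightarrow> bool" where
  "follows d d' \<longleftrightarrow> snd (snd d) = fst d' \<and> fst (snd d) \<noteq> fst (snd d')"

interpretation dart_walks: reversible_steps "darts G F" turn follows for G F
  by unfold_locales (auto simp: darts_def turn_def follows_def insert_commute)

lemma dart_walks_iff:
  "A \<in> dart_walks.walks G F n \<longleftrightarrow> length A = n \<and>
     (\<forall>(x, e, y)\<in>set A. e \<in> F \<and> ends G e = {x, y}) \<and> successively follows A"
  unfolding dart_walks.walks_def by (auto simp: darts_def)

definition arc_of :: "('v \<times> 'e \<times> 'v) list \<Rightarrow> ('v, 'e) arc" where
  "arc_of A = (fst (hd A) # map (snd \<circ> snd) A, map (fst \<circ> snd) A)"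

text \<open>In \<open>arc_of\<close> all vertices but the first are heads of darts; the walk condition makes them tails of
the next darts as well.\<close>

lemma tail_nth:
  assumes "successively follows A" "i < length A"
  shows "(fst (hd A) # map (snd \<circ> snd) A) ! i = fst (A ! i)"
proof (cases i)
  case (Suc j)
  then show ?thesis
    using assms by (simp add: successively_conv_nth follows_def)
qed (use assms in \<open>simp add: hd_conv_nth\<close>)

lemma is_arc_arc_of:
  assumes g: "graph G" and F: "F \<subseteq> edges G" and A: "A \<in> dart_walks.walks G F n" and n: "n > 0"
  shows "is_arc G n (arc_of A)"
proof -
  have len: "length A = n" and D: "set A \<subseteq> darts G F" and succ: "successively follows A"
    using A by (auto simp: dart_walks.walks_def)
  have dart: "fst (snd d) \<in> F" "ends G (fst (snd d)) = {fst d, snd (snd d)}" if "d \<in> set A" for d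
    using that D by (auto simp: darts_def)
  have ends_in: "fst d \<in> verts G" "snd (snd d) \<in> verts G" if "d \<in> set A" for d
    using dart[OF that] F g by (auto simp: graph_def)
  have "hd A \<in> set A" using len n by (cases A) auto
  then have "set (fst (hd A) # map (snd \<circ> snd) A) \<subseteq> verts G"
    using ends_in by auto
  moreover have "set (map (fst \<circ> snd) A) \<subseteq> edges G" using dart F by auto
  moreover have "ends G (map (fst \<circ> snd) A ! i) =
      {(fst (hd A) # map (snd \<circ> snd) A) ! i, (fst (hd A) # map (snd \<circ> snd) A) ! Suc i}" if "i < n" for i
    using that len tail_nth[OF succ] dart[of "A ! i"] by simp
  moreover have "map (fst \<circ> snd) A ! i \<noteq> map (fst \<circ> snd) A ! Suc i" if "Suc i < n" for i
    using that len succ by (simp add: successively_conv_nth follows_def)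
  ultimately show ?thesis
    unfolding is_arc_def arc_of_def using len by simp
qed

lemma arc_of_reversal:
  assumes "A \<in> dart_walks.walks G F n" "n > 0"
  shows "arc_of (dart_walks.reversal A) = (rev (fst (arc_of A)), rev (snd (arc_of A)))"
proof -
  have "successively follows A" "A \<noteq> []" using assms by (auto simp: dart_walks.walks_def)
  then have "snd (snd (last A)) # map (snd \<circ> snd) (map turn (rev A)) =
      rev (fst (hd A) # map (snd \<circ> snd) A)"
  proof (induction A)
    case (Cons d A)
    show ?case
    proof (cases A)
      case (Cons d' B)
      then show ?thesis
        using Cons.prems Cons.IH by (auto simp: turn_def follows_def)
    qed (simp add: turn_def)
  qed simp
  moreover have "hd (map turn (rev A)) = turn (last A)"
    using \<open>A \<noteq> []\<close> by (simp add: hd_map hd_rev)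
  ultimately show ?thesis
    by (simp add: arc_of_def dart_walks.reversal_def turn_def rev_map comp_def)
qed

lemma arc_of_inject:
  assumes "A \<in> dart_walks.walks G F n" "B \<in> dart_walks.walks G F n" "arc_of A = arc_of B"
  shows "A = B"
proof (rule nth_equalityI)
  have AB: "successively follows A" "successively follows B" "length A = n" "length B = n"
    using assms by (auto simp: dart_walks.walks_def)
  then show "length A = length B" by simp
  fix i assume i: "i < length A"
  have "fst (A ! i) = fst (B ! i)"
    using tail_nth[OF AB(1), of i] tail_nth[OF AB(2), of i] i AB(3,4) assms(3)
    by (simp add: arc_of_def)
  moreover have "snd (A ! i) = snd (B ! i)"
  proof (rule prod_eqI)
    have "map (fst \<circ> snd) A ! i = map (fst \<circ> snd) B ! i"
      "map (snd \<circ> snd) A ! i = map (snd \<circ> snd) B ! i"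
      using assms(3) by (simp_all add: arc_of_def)
    then show "fst (snd (A ! i)) = fst (snd (B ! i))" "snd (snd (A ! i)) = snd (snd (B ! i))"
      using i AB(3,4) by simp_all
  qed
  ultimately show "A ! i = B ! i" by (rule prod_eqI)
qed

lemma link_of_eq_iff: "link_of A = link_of B \<longleftrightarrow> B = A \<or> B = (rev (fst A), rev (snd A))"
  by (cases A; cases B) (auto simp: link_of_def doubleton_eq_iff)

text \<open>In a shortest counterexample only the first and the last vertex can coincide, and then it is a cycle of
length at most \<open>l\<close>.\<close>

lemma arc_distinct:
  assumes g: "graph G" and girth: "girth G \<ge> enat (Suc l)"
  shows "is_arc G n (vs, es) \<Longrightarrow> n \<le> l \<Longrightarrow> distinct vs"
proof (induction n arbitrary: vs es)
  case 0
  then show ?case by (cases vs) (auto simp: is_arc_def)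
next
  case (Suc n)
  have vs: "length vs = Suc (Suc n)" and es: "length es = Suc n"
    and sub: "set vs \<subseteq> verts G" "set es \<subseteq> edges G"
    and inc: "\<And>i. i < Suc n \<Longrightarrow> ends G (es ! i) = {vs ! i, vs ! Suc i}"
    and neq: "\<And>i. Suc i < Suc n \<Longrightarrow> es ! i \<noteq> es ! Suc i"
    using Suc.prems(1) by (auto simp: is_arc_def)
  have front: "is_arc G n (take (Suc n) vs, take n es)"
    using vs es sub inc neq set_take_subset[of _ vs] set_take_subset[of _ es]
    by (auto simp: is_arc_def dest: in_set_takeD)
  have "is_arc G n (tl vs, tl es)"
    using vs es sub inc neq by (auto simp: is_arc_def nth_tl dest: list.set_sel(2)[rotated])
  then have dtl: "distinct (tl vs)" and dfront: "distinct (take (Suc n) vs)"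
    using Suc.IH front Suc.prems(2) by auto
  have "vs ! 0 \<noteq> vs ! Suc n"
  proof
    assume closed: "vs ! 0 = vs ! Suc n"
    have "n \<noteq> 0"
    proof
      assume "n = 0"
      then have "ends G (es ! 0) = {vs ! 0}" using inc[of 0] closed by simp
      moreover have "es ! 0 \<in> edges G" using sub es by auto
      ultimately show False using g by (auto simp: graph_def)
    qed
    moreover have "sublink (vs, es) 0 n \<in> paths G n"
      unfolding sublink_def paths_def using front dfront by auto
    ultimately have "link_of (vs, es) \<in> cycles G (Suc n)"
      using Suc.prems(1) closed unfolding cycles_def by auto
    then have "girth G \<le> enat (Suc n)"
      unfolding girth_def by (intro Inf_lower) auto
    then have "enat (Suc l) \<le> enat (Suc n)" using girth by (rule order_trans[rotated])
    then show False using Suc.prems(2) by simp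
  qed
  moreover have "vs = vs ! 0 # tl vs" using vs by (cases vs) auto
  moreover have "vs ! 0 \<notin> set (tl vs) \<or> vs ! 0 = last vs"
  proof -
    have "take (Suc n) vs = vs ! 0 # butlast (tl vs)"
      using vs by (cases vs) (auto simp: butlast_conv_take)
    moreover have "tl vs = butlast (tl vs) @ [last vs]"
      using vs by (cases vs) (auto simp: append_butlast_last_id)
    ultimately show ?thesis
      using dfront by (metis Un_iff distinct.simps(2) empty_iff empty_set insert_iff list.simps(15) set_append)
  qed
  moreover have "last vs = vs ! Suc n" using vs by (simp add: last_conv_nth flip: length_0_conv)
  ultimately show ?case using dtl by (metis distinct.simps(2))
qed

lemma finite_paths:
  assumes "graph G"
  shows "finite (paths G n)"
proof -
  let ?A = "{vs. set vs \<subseteq> verts G \<and> length vs = Suc n} \<times> {es. set es \<subseteq> edges G \<and> length es = n}"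
  have "finite ?A" using assms by (simp add: graph_def finite_lists_length_eq)
  moreover have "paths G n \<subseteq> link_of ` ?A"
    by (auto simp: paths_def is_arc_def)
  ultimately show ?thesis by (meson finite_imageI finite_subset)
qed

lemma graph_path_graph:
  assumes "graph G"
  shows "graph (path_graph l G)"
proof -
  let ?E = "{{L, R} | L R. L \<in> paths G l \<and> R \<in> paths G l \<and> path_adjacent G l L R}"
  have "?E \<subseteq> Pow (paths G l)" by auto
  then have "finite ?E" using finite_paths[OF assms] by (meson finite_Pow_iff finite_subset)
  moreover have "e \<subseteq> paths G l \<and> card e = 2" if "e \<in> ?E" for e
    using that by (auto simp: card_2_iff path_adjacent_def simp del: split_paired_Ex)
  ultimately show ?thesis
    using finite_paths[OF assms] by (simp add: graph_def path_graph_def)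
qed

definition link_of_walk :: "('v \<times> 'e \<times> 'v) list \<Rightarrow> ('v, 'e) link" where
  "link_of_walk A = link_of (arc_of A)"

context
  fixes G :: "('v, 'e) mgraph" and F :: "'e set" and l :: nat
  assumes g: "graph G" and F: "F \<subseteq> edges G" and girth: "girth G \<ge> enat (Suc l)" and l: "l > 0"
begin

lemma walk_distinct:
  assumes "A \<in> dart_walks.walks G F l"
  shows "distinct (fst (arc_of A))"
  using arc_distinct[OF g girth, of l "fst (arc_of A)" "snd (arc_of A)"]
    is_arc_arc_of[OF g F assms l] by simp

lemma link_of_walk_paths: "A \<in> dart_walks.walks G F l \<Longrightarrow> link_of_walk A \<in> paths G l"
  using walk_distinct is_arc_arc_of[OF g F _ l] unfolding paths_def link_of_walk_def by blast

lemma link_of_walk_reversal: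
  assumes "A \<in> dart_walks.walks G F l"
  shows "link_of_walk (dart_walks.reversal A) = link_of_walk A"
  using arc_of_reversal[OF assms l] by (simp add: link_of_walk_def link_of_eq_iff)

lemma link_of_walk_eqD:
  assumes "A \<in> dart_walks.walks G F l" "B \<in> dart_walks.walks G F l" "link_of_walk A = link_of_walk B"
  shows "B = A \<or> B = dart_walks.reversal A"
proof -
  have "arc_of B = arc_of A \<or> arc_of B = arc_of (dart_walks.reversal A)"
    using assms arc_of_reversal[OF assms(1) l] by (simp add: link_of_walk_def link_of_eq_iff)
  then show ?thesis
    using arc_of_inject[OF assms(2)] assms(1) dart_walks.reversal_walks by blast
qed

text \<open>The first \<open>l + 1\<close> vertices of \<open>Q\<close> are distinct, and so are the last \<open>l + 1\<close>. Hence \<open>Q\<close> is a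
path, or a cycle if its two ends coincide.\<close>

lemma path_graph_adj:
  assumes Q: "Q \<in> dart_walks.walks G F (Suc l)"
    and neq: "link_of_walk (butlast Q) \<noteq> link_of_walk (tl Q)"
  shows "adj (path_graph l G) (link_of_walk (butlast Q)) (link_of_walk (tl Q))"
proof -
  obtain d A d' where Qd: "Q = d # A @ [d']"
    and dA: "d # A \<in> dart_walks.walks G F l" "A @ [d'] \<in> dart_walks.walks G F l"
    using dart_walks.walks_Suc_cases[OF Q l] by blast
  have len: "l = Suc (length A)" using dA by (auto simp: dart_walks.walks_def)
  have bt: "butlast Q = d # A" "tl Q = A @ [d']" by (simp_all add: Qd butlast_append)
  obtain vs es where arc: "arc_of Q = (vs, es)" by fastforce
  have arcQ: "is_arc G (l + 1) (arc_of Q)" using is_arc_arc_of[OF g F Q] by simp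
  have "snd (snd d) = fst (hd (A @ [d']))"
    using Q by (cases A) (auto simp: Qd dart_walks.walks_def follows_def)
  then have front: "(take (Suc l) vs, take l es) = arc_of (d # A)"
    and rear: "(take (Suc l) (drop 1 vs), take l (drop 1 es)) = arc_of (A @ [d'])"
    using arc by (auto simp: Qd arc_of_def len)
  have sub: "sublink (arc_of Q) 0 l = link_of_walk (butlast Q)"
      "sublink (arc_of Q) 1 (l + 1) = link_of_walk (tl Q)"
    using front rear by (simp_all add: sublink_def arc bt link_of_walk_def)
  have dist: "distinct (take (Suc l) vs)" "distinct (take (Suc l) (drop 1 vs))"
    using walk_distinct[OF dA(1)] walk_distinct[OF dA(2)] front rear by (metis fst_conv)+
  have vs: "length vs = Suc (Suc l)" using arcQ arc by (simp add: is_arc_def)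
  have "link_of (arc_of Q) \<in> paths G (l + 1) \<union> cycles G (l + 1)"
  proof (cases "vs ! 0 = vs ! Suc l")
    case True
    moreover have "sublink (arc_of Q) 0 l \<in> paths G l"
      using link_of_walk_paths[OF dA(1)] sub bt by simp
    ultimately have "link_of (arc_of Q) \<in> cycles G (l + 1)"
      unfolding cycles_def using arcQ l arc by fastforce
    then show ?thesis ..
  next
    case False
    obtain x ws where vs_eq: "vs = x # ws" "length ws = Suc l" using vs by (cases vs) auto
    then have "ws = take l ws @ [ws ! l]" by (metis lessI take_Suc_conv_app_nth take_all_iff le_refl)
    moreover have "distinct ws" "x \<notin> set (take l ws)" using dist vs_eq by auto
    moreover have "x \<noteq> ws ! l" using False vs_eq by simp
    ultimately have "distinct vs"
      unfolding vs_eq(1) by (metis Un_iff distinct.simps(2) empty_iff empty_set insert_iff list.simps(15) set_append)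
    then have "link_of (arc_of Q) \<in> paths G (l + 1)"
      unfolding paths_def using arcQ arc by fastforce
    then show ?thesis ..
  qed
  then have "path_adjacent G l (link_of_walk (butlast Q)) (link_of_walk (tl Q))"
    unfolding path_adjacent_def using neq arcQ sub by blast
  moreover have "link_of_walk (butlast Q) \<in> paths G l" "link_of_walk (tl Q) \<in> paths G l"
    using dA link_of_walk_paths bt by simp_all
  ultimately show ?thesis
    unfolding adj_def path_graph_def by auto
qed

lemma clique_colouring_path_graph:
  assumes col: "clique_colouring (dart_walks.neighbour G F) (dart_walks.walks G F l) t f"
    and f_rev: "\<And>A. A \<in> dart_walks.walks G F l \<Longrightarrow> f (dart_walks.reversal A) = f A"
  shows "\<exists>f'. clique_colouring (adj (path_graph l G)) (verts (path_graph l G)) t f'"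
proof -
  have "\<exists>f'. clique_colouring (adj (path_graph l G)) (verts (path_graph l G)) t f' \<and>
          (\<forall>A\<in>dart_walks.walks G F l. f' (link_of_walk A) = f A)"
  proof (rule clique_colouring_image[OF col])
    show "link_of_walk ` dart_walks.walks G F l \<subseteq> verts (path_graph l G)"
      using link_of_walk_paths by (auto simp: path_graph_def)
  next
    fix A B assume "A \<in> dart_walks.walks G F l" "B \<in> dart_walks.walks G F l"
      and "link_of_walk A = link_of_walk B"
    then show "f A = f B" using link_of_walk_eqD[of A B] f_rev by auto
  next
    fix A B assume A: "A \<in> dart_walks.walks G F l" and B: "B \<in> dart_walks.walks G F l"
      and "dart_walks.neighbour G F A B"
    then consider "B = dart_walks.reversal A" | "dart_walks.shift G F A B" | "dart_walks.shift G F B A"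
      by (auto simp: dart_walks.neighbour_def)
    then show "link_of_walk A = link_of_walk B \<or> adj (path_graph l G) (link_of_walk A) (link_of_walk B)"
    proof cases
      case 1
      then show ?thesis using link_of_walk_reversal[OF A] by simp
    next
      case 2
      then show ?thesis using path_graph_adj unfolding dart_walks.shift_iff[OF A] by blast
    next
      case 3
      then show ?thesis
        using path_graph_adj adj_commute unfolding dart_walks.shift_iff[OF B] by metis
    qed
  qed
  then show ?thesis by blast
qed

end

abbreviation first_edge :: "('v \<times> 'e \<times> 'v) list \<Rightarrow> 'e" where
  "first_edge A \<equiv> fst (snd (hd A))"

lemma walk_through_edge:
  assumes "e \<in> F" "ends G e = {x, y}"
  shows "[(x, e, y)] \<in> dart_walks.walks G F (Suc 0)"
  using assms by (simp add: dart_walks_iff)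

lemma walks_one_eq:
  "A \<in> dart_walks.walks G F (Suc 0) \<longleftrightarrow> (\<exists>x e y. A = [(x, e, y)] \<and> e \<in> F \<and> ends G e = {x, y})"
  by (auto simp: dart_walks_iff length_Suc_conv)

lemma shift_of_meets:
  assumes g: "graph G" and F: "F \<subseteq> edges G" and e: "e \<in> F" "e' \<in> F" "e \<noteq> e'" "meets G e e'"
  obtains A B where "A \<in> dart_walks.walks G F (Suc 0)" "B \<in> dart_walks.walks G F (Suc 0)"
    "first_edge A = e" "first_edge B = e'" "dart_walks.shift G F A B"
proof -
  obtain x where x: "x \<in> ends G e" "x \<in> ends G e'" using e(4) by (auto simp: meets_def)
  have "e \<in> edges G" "e' \<in> edges G" using e F by auto
  obtain y where y: "ends G e = {x, y}"
    by (rule graph_other_endE[OF g \<open>e \<in> edges G\<close> x(1)])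
  obtain z where z: "ends G e' = {x, z}"
    by (rule graph_other_endE[OF g \<open>e' \<in> edges G\<close> x(2)])
  note yz = y z
  let ?A = "[(y, e, x)]" and ?B = "[(x, e', z)]"
  have "[(y, e, x), (x, e', z)] \<in> dart_walks.walks G F (Suc (Suc 0))"
    using yz e by (auto simp: dart_walks_iff follows_def insert_commute)
  then have "dart_walks.shift G F ?A ?B"
    unfolding dart_walks.shift_def by (intro bexI[of _ "[(y, e, x), (x, e', z)]"]) simp_all
  moreover have "?A \<in> dart_walks.walks G F (Suc 0)" "?B \<in> dart_walks.walks G F (Suc 0)"
    using yz e by (auto simp: walks_one_eq insert_commute)
  ultimately show ?thesis using that[of ?A ?B] by simp
qed

text \<open>A walk of length one is an edge with a direction; its two directions are adjacent by reversal, and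
one of them always fits when an incident edge is to be joined.\<close>

lemma clique_colouring_walks_one:
  assumes g: "graph G" and F: "F \<subseteq> edges G" and col: "clique_colouring (meets G) F t c"
  shows "clique_colouring (dart_walks.neighbour G F) (dart_walks.walks G F (Suc 0)) t (c \<circ> first_edge)"
proof (rule clique_colouring_preimage[OF col])
  show "first_edge ` dart_walks.walks G F (Suc 0) = F"
  proof
    show "F \<subseteq> first_edge ` dart_walks.walks G F (Suc 0)"
    proof
      fix e assume e: "e \<in> F"
      then have "e \<in> edges G" using F by blast
      then obtain x y where "ends G e = {x, y}" by (rule graph_endsE[OF g])
      then show "e \<in> first_edge ` dart_walks.walks G F (Suc 0)"
        using walk_through_edge[OF e] by (intro image_eqI[of _ _ "[(x, e, y)]"]) simp_all
    qed
  qed (auto simp: walks_one_eq)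
next
  fix A B assume AB: "A \<in> dart_walks.walks G F (Suc 0)" "B \<in> dart_walks.walks G F (Suc 0)"
    "c (first_edge A) = c (first_edge B)" and close: "first_edge A = first_edge B \<or> meets G (first_edge A) (first_edge B)"
  let ?C = "{X \<in> dart_walks.walks G F (Suc 0). c (first_edge X) = c (first_edge A)}"
  let ?R = "step_in (dart_walks.neighbour G F) ?C"
  have same: "?R\<^sup>*\<^sup>* X Y" if X: "X \<in> ?C" and Y: "Y \<in> ?C" and XY: "first_edge X = first_edge Y" for X Y
  proof -
    obtain x e y where Xd: "X = [(x, e, y)]" "ends G e = {x, y}"
      using X by (auto simp: walks_one_eq)
    obtain x' y' where Yd: "Y = [(x', e, y')]" "ends G e = {x', y'}"
      using Y XY Xd by (auto simp: walks_one_eq)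
    have "Y = X \<or> Y = dart_walks.reversal X"
      using Xd Yd by (auto simp: dart_walks.reversal_def turn_def doubleton_eq_iff)
    then show ?thesis
    proof
      assume "Y = dart_walks.reversal X"
      then have "?R X Y" using X Y by (simp add: step_in_def dart_walks.neighbour_def)
      then show ?thesis by blast
    qed simp
  qed
  show "?R\<^sup>*\<^sup>* A B"
  proof (cases "first_edge A = first_edge B")
    case True
    then show ?thesis using same AB by simp
  next
    case False
    have "first_edge A \<in> F" "first_edge B \<in> F" using AB by (auto simp: walks_one_eq)
    then obtain P Q where PQ: "P \<in> dart_walks.walks G F (Suc 0)" "Q \<in> dart_walks.walks G F (Suc 0)"
      "first_edge P = first_edge A" "first_edge Q = first_edge B" "dart_walks.shift G F P Q"
      using shift_of_meets[OF g F] False close by metis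
    then have "?R P Q" using AB by (simp add: step_in_def dart_walks.neighbour_def)
    moreover have "?R\<^sup>*\<^sup>* A P" "?R\<^sup>*\<^sup>* Q B" using same PQ AB by simp_all
    ultimately show ?thesis by (meson converse_rtranclp_into_rtranclp rtranclp_trans)
  qed
next
  fix e e' assume "e \<in> F" "e' \<in> F" "meets G e e'" "c e \<noteq> c e'"
  then show "\<exists>A\<in>dart_walks.walks G F (Suc 0). \<exists>B\<in>dart_walks.walks G F (Suc 0).
      first_edge A = e \<and> first_edge B = e' \<and> dart_walks.neighbour G F A B"
    using shift_of_meets[OF g F, of e e'] unfolding dart_walks.neighbour_def by metis
qed

lemma first_edge_reversal:
  "A \<in> dart_walks.walks G F (Suc 0) \<Longrightarrow> first_edge (dart_walks.reversal A) = first_edge A"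
  by (auto simp: walks_one_eq dart_walks.reversal_def turn_def)

text \<open>The function \<open>s\<close> says which second edge each edge at a vertex claims for a walk of its own colour; two
edges may claim each other only if their colours agree. If there are three edges, they are arranged in
a cycle and all others point to it.\<close>

lemma choose_continuations:
  assumes "\<forall>e\<in>X. \<exists>f\<in>X. f \<noteq> e \<and> (c f = c e \<or> (\<exists>g\<in>X. g \<noteq> e \<and> g \<noteq> f))"
  shows "\<exists>s. \<forall>e\<in>X. s e \<in> X \<and> s e \<noteq> e \<and> (s (s e) = e \<longrightarrow> c (s e) = c e)"
proof (cases "\<exists>p\<in>X. \<exists>q\<in>X. \<exists>r\<in>X. p \<noteq> q \<and> p \<noteq> r \<and> q \<noteq> r")
  case True
  then obtain p q r where "p \<in> X" "q \<in> X" "r \<in> X" "p \<noteq> q" "p \<noteq> r" "q \<noteq> r" by blast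
  then show ?thesis
    by (intro exI[of _ "\<lambda>e. if e = p then q else if e = q then r else p"]) auto
next
  case False
  then have "\<forall>e\<in>X. \<exists>f\<in>X. f \<noteq> e \<and> c f = c e" using assms by metis
  then show ?thesis by metis
qed

lemma supports_one:
  assumes g: "graph G" and F: "F \<subseteq> edges G" and cont: "continuable G F c"
  shows "\<exists>h. dart_walks.supports G F (Suc 0) (c \<circ> first_edge) h"
proof -
  let ?E = "\<lambda>x. {e \<in> F. x \<in> ends G e}"
  have "\<exists>s. \<forall>e\<in>?E x. s e \<in> ?E x \<and> s e \<noteq> e \<and> (s (s e) = e \<longrightarrow> c (s e) = c e)" for x
  proof (rule choose_continuations, intro ballI)
    fix e assume "e \<in> ?E x"
    then obtain f where "f \<in> F" "f \<noteq> e" "x \<in> ends G f"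
      "c f = c e \<or> (\<exists>g\<in>F. g \<noteq> e \<and> g \<noteq> f \<and> x \<in> ends G g)"
      using cont unfolding continuable_def by blast
    then show "\<exists>f\<in>?E x. f \<noteq> e \<and> (c f = c e \<or> (\<exists>g\<in>?E x. g \<noteq> e \<and> g \<noteq> f))" by blast
  qed
  then have "\<exists>s. \<forall>x. \<forall>e\<in>?E x. s x e \<in> ?E x \<and> s x e \<noteq> e \<and> (s x (s x e) = e \<longrightarrow> c (s x e) = c e)"
    by (intro choice allI)
  then obtain s where s: "\<And>x e. e \<in> ?E x \<Longrightarrow> s x e \<in> ?E x \<and> s x e \<noteq> e \<and>
      (s x (s x e) = e \<longrightarrow> c (s x e) = c e)"
    by blast
  \<comment> \<open>The last case is reached if neither edge claims the other; the minimum makes \<open>\<gamma> x\<close>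
    symmetric.\<close>
  define \<gamma> where "\<gamma> x e f = (if s x e = f then c e else if s x f = e then c f else min (c e) (c f))" for x e f
  have \<gamma>_sym: "\<gamma> x e f = \<gamma> x f e" if "e \<in> ?E x" "f \<in> ?E x" for x e f
    using s that by (auto simp: \<gamma>_def)
  have \<gamma>_in: "\<gamma> x e f \<in> {c e, c f}" for x e f by (auto simp: \<gamma>_def min_def)
  define h where "h A = \<gamma> (snd (snd (hd A))) (fst (snd (hd A))) (fst (snd (hd (tl A))))"
    for A :: "('a \<times> 'b \<times> 'a) list"
  have two: "\<exists>x e y f z. Q = [(x, e, y), (y, f, z)] \<and> e \<in> ?E y \<and> f \<in> ?E y"
    if "Q \<in> dart_walks.walks G F (Suc (Suc 0))" for Q
  proof -
    have "\<exists>d d'. Q = [d, d']" using that by (auto simp: dart_walks_iff length_Suc_conv)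
    then obtain x e y x' f z where "Q = [(x, e, y), (x', f, z)]" by auto
    then show ?thesis
      using that by (auto simp: dart_walks_iff follows_def)
  qed
  have "dart_walks.supports G F (Suc 0) (c \<circ> first_edge) h"
    unfolding dart_walks.supports_def
  proof (intro conjI ballI)
    fix A assume A: "A \<in> dart_walks.walks G F (Suc 0)"
    show "(c \<circ> first_edge) (dart_walks.reversal A) = (c \<circ> first_edge) A"
      using first_edge_reversal[OF A] by simp
    obtain x e y where Ad: "A = [(x, e, y)]" "e \<in> F" "ends G e = {x, y}"
      using A by (auto simp: walks_one_eq)
    then have next_e: "s y e \<in> F" "y \<in> ends G (s y e)" "s y e \<noteq> e" using s[of e y] by auto
    obtain z where z: "ends G (s y e) = {y, z}"
      using graph_other_endE[OF g, of "s y e" y] next_e F by blast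
    have "A @ [(y, s y e, z)] \<in> dart_walks.walks G F (Suc (Suc 0))"
      using Ad next_e z by (auto simp: dart_walks_iff follows_def)
    moreover have "h (A @ [(y, s y e, z)]) = (c \<circ> first_edge) A"
      by (simp add: h_def Ad \<gamma>_def)
    ultimately show "\<exists>d. A @ [d] \<in> dart_walks.walks G F (Suc (Suc 0)) \<and> h (A @ [d]) = (c \<circ> first_edge) A"
      by blast
  next
    fix Q assume "Q \<in> dart_walks.walks G F (Suc (Suc 0))"
    then obtain x e y f z where Q: "Q = [(x, e, y), (y, f, z)]" "e \<in> ?E y" "f \<in> ?E y"
      using two by blast
    then show "h (dart_walks.reversal Q) = h Q"
      using \<gamma>_sym[OF Q(2,3)] by (simp add: h_def dart_walks.reversal_def turn_def)
    show "h Q \<in> {(c \<circ> first_edge) (butlast Q), (c \<circ> first_edge) (tl Q)}"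
      using \<gamma>_in by (simp add: h_def Q(1))
  qed
  then show ?thesis by blast
qed

lemma path_graph_minor_of_continuable:
  assumes "graph G" "F \<subseteq> edges G" "girth G \<ge> enat (Suc l)" "l > 0"
    and "continuable G F c" and "clique_colouring (meets G) F t c"
  shows "t \<le> hadwiger (path_graph l G)"
proof -
  obtain h where "dart_walks.supports G F (Suc 0) (c \<circ> first_edge) h"
    using supports_one assms by blast
  then have "\<exists>f h. dart_walks.supports G F (Suc (l - 1)) f h \<and>
      clique_colouring (dart_walks.neighbour G F) (dart_walks.walks G F (Suc (l - 1))) t f"
    using dart_walks.clique_colouring_climb clique_colouring_walks_one assms by blast
  then obtain f h where "dart_walks.supports G F l f h"
    and col: "clique_colouring (dart_walks.neighbour G F) (dart_walks.walks G F l) t f"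
    using assms(4) by auto
  then have "f (dart_walks.reversal A) = f A" if "A \<in> dart_walks.walks G F l" for A
    using that by (simp add: dart_walks.supports_def)
  then show ?thesis
    using clique_colouring_path_graph[OF assms(1-4) col] le_hadwigerI graph_path_graph assms(1) by blast
qed

text \<open>For \<open>l = 1\<close> the paths are the edges themselves, so the colour classes of the edges already are the
branch sets.\<close>

lemma line_graph_minor:
  assumes "graph G" "F \<subseteq> edges G" "girth G \<ge> enat (Suc (Suc 0))"
    and "clique_colouring (meets G) F t c"
  shows "t \<le> hadwiger (path_graph (Suc 0) G)"
proof -
  have "\<exists>f. clique_colouring (adj (path_graph (Suc 0) G)) (verts (path_graph (Suc 0) G)) t f"
    by (rule clique_colouring_path_graph[OF assms(1-3) _ clique_colouring_walks_one[OF assms(1,2,4)]])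
       (simp_all add: first_edge_reversal)
  then show ?thesis using le_hadwigerI graph_path_graph assms(1) by blast
qed


section \<open>Small clique minors\<close>

lemma linked_singleton: "linked r {x}"
  by (simp add: linked_def)

lemma linked_interval: "linked (\<lambda>i j. j = Suc i \<or> i = Suc j) {m..<n}"
proof -
  let ?R = "step_in (\<lambda>i j. j = Suc i \<or> i = Suc j) {m..<n}"
  have both: "?R\<^sup>*\<^sup>* m x \<and> ?R\<^sup>*\<^sup>* x m" if "m \<le> x" "x < n" for x
    using that
  proof (induction x rule: dec_induct)
    case (step x)
    then have "?R x (Suc x)" "?R (Suc x) x" by (auto simp: step_in_def)
    then show ?case
      using step by (meson Suc_lessD converse_rtranclp_into_rtranclp rtranclp.rtrancl_into_rtrancl)
  qed simp
  show ?thesis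
    unfolding linked_def
  proof (intro ballI)
    fix x y assume "x \<in> {m..<n}" "y \<in> {m..<n}"
    then show "?R\<^sup>*\<^sup>* x y" using both[of x] both[of y] by (auto intro: rtranclp_trans)
  qed
qed

text \<open>Up to the first repetition, the walk runs through a cycle of length at least three. Two consecutive
vertices of the cycle and the remaining arc are three branch sets.\<close>

lemma triangle_minor_of_walk:
  assumes P: "graph P" and w: "\<And>i. adj P (w i) (w (Suc i))" "\<And>i::nat. w i \<noteq> w (Suc (Suc i))"
  shows "3 \<le> hadwiger P"
proof -
  have "range w \<subseteq> verts P" using w(1) adj_verts[OF P] by blast
  then have "finite (range w)" using P by (auto simp: graph_def finite_subset)
  then have "\<not> inj w" using finite_imageD by blast
  then have ex: "\<exists>b a. a < b \<and> w a = w b" by (metis injI linorder_neqE_nat)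
  define b where "b = (LEAST b. \<exists>a<b. w a = w b)"
  have "\<exists>a<b. w a = w b" unfolding b_def using ex by (rule LeastI_ex)
  then obtain a where ab: "a < b" "w a = w b" by blast
  have inj: "w i \<noteq> w j" if "i < j" "j < b" for i j
    using that not_less_Least[of j "\<lambda>b. \<exists>a<b. w a = w b"] unfolding b_def by blast
  have "b \<noteq> Suc a" using ab w(1)[of a] adj_verts[OF P] by metis
  moreover have "b \<noteq> Suc (Suc a)" using ab w(2)[of a] by metis
  ultimately have ab3: "Suc (Suc a) < b" using ab(1) by linarith
  define r where "r i j \<longleftrightarrow> j = Suc i \<or> i = Suc j \<or> (i = a \<and> j = b - 1) \<or> (i = b - 1 \<and> j = a)" for i j
  define f where "f i = (if i = a then 0 else if i = Suc a then 1 else 2 :: nat)" for i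
  have cls: "{i \<in> {a..<b}. f i = 0} = {a}" "{i \<in> {a..<b}. f i = 1} = {Suc a}"
      "{i \<in> {a..<b}. f i = 2} = {Suc (Suc a)..<b}"
    using ab3 by (auto simp: f_def split: if_splits)
  have "linked r ((\<lambda>x. x) ` {Suc (Suc a)..<b})"
    by (rule linked_image[OF linked_interval]) (auto simp: r_def)
  then have lk: "linked r {Suc (Suc a)..<b}" by simp
  have "clique_colouring r {a..<b} 3 f"
    unfolding clique_colouring_def
  proof (intro conjI allI impI)
    fix i :: nat assume "i < 3"
    then have "i = 0 \<or> i = 1 \<or> i = 2" by linarith
    then have "{x \<in> {a..<b}. f x = i} \<in> {{a}, {Suc a}, {Suc (Suc a)..<b}}"
      by (elim disjE) (simp_all only: cls insert_iff simp_thms)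
    then show "{x \<in> {a..<b}. f x = i} \<noteq> {}" "linked r {x \<in> {a..<b}. f x = i}"
      using ab3 lk linked_singleton by auto
  next
    fix i j :: nat assume ij: "i < 3" "j < 3" "i \<noteq> j"
    have pairs: "f a = 0" "f (Suc a) = 1" "f (Suc (Suc a)) = 2" "f (b - 1) = 2"
      using ab3 by (auto simp: f_def)
    have rel: "r a (Suc a)" "r (Suc a) a" "r (Suc a) (Suc (Suc a))" "r (Suc (Suc a)) (Suc a)"
        "r a (b - 1)" "r (b - 1) a"
      by (simp_all add: r_def)
    have mem: "a \<in> {a..<b}" "Suc a \<in> {a..<b}" "Suc (Suc a) \<in> {a..<b}" "b - 1 \<in> {a..<b}"
      using ab3 by auto
    from ij have "i = 0 \<or> i = 1 \<or> i = 2" "j = 0 \<or> j = 1 \<or> j = 2" by linarith+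
    with ij consider "i = 0" "j = 1" | "i = 1" "j = 0" | "i = 1" "j = 2" | "i = 2" "j = 1"
      | "i = 0" "j = 2" | "i = 2" "j = 0"
      by blast
    then show "\<exists>x\<in>{a..<b}. \<exists>y\<in>{a..<b}. f x = i \<and> f y = j \<and> r x y"
      by cases (use pairs rel mem in blast)+
  qed
  then have "\<exists>f'. clique_colouring (adj P) (verts P) 3 f' \<and> (\<forall>x\<in>{a..<b}. f' (w x) = f x)"
  proof (rule clique_colouring_image)
    show "w ` {a..<b} \<subseteq> verts P" using \<open>range w \<subseteq> verts P\<close> by blast
  next
    fix i j assume "i \<in> {a..<b}" "j \<in> {a..<b}" "w i = w j"
    then show "f i = f j" using inj[of i j] inj[of j i] by (metis atLeastLessThan_iff linorder_neqE_nat)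
  next
    fix i j assume "r i j"
    moreover have "adj P (w (b - 1)) (w a)"
      using w(1)[of "b - 1"] ab by simp
    ultimately show "w i = w j \<or> adj P (w i) (w j)"
      using w(1) adj_commute[of P] by (auto simp: r_def)
  qed
  then show ?thesis using le_hadwigerI[OF P] by blast
qed

lemma edge_minor:
  assumes P: "graph P" and "edges P \<noteq> {}"
  shows "2 \<le> hadwiger P"
proof -
  obtain e where "e \<in> edges P" using assms(2) by blast
  then obtain x y where xy: "ends P e = {x, y}" "x \<noteq> y" "x \<in> verts P" "y \<in> verts P"
    by (rule graph_endsE[OF P])
  then have a: "adj P x y" "adj P y x" using \<open>e \<in> edges P\<close> by (auto simp: adj_def insert_commute)
  define f where "f z = (if z = x then 0 else if z = y then 1 else 2 :: nat)" for z
  have cls: "{z \<in> verts P. f z = 0} = {x}" "{z \<in> verts P. f z = 1} = {y}"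
    using xy by (auto simp: f_def)
  have "clique_colouring (adj P) (verts P) 2 f"
    unfolding clique_colouring_def
  proof (intro conjI allI impI)
    fix i :: nat assume "i < 2"
    then have "i = 0 \<or> i = 1" by linarith
    then have "{z \<in> verts P. f z = i} \<in> {{x}, {y}}"
      by (elim disjE) (simp_all only: cls insert_iff simp_thms)
    then show "{z \<in> verts P. f z = i} \<noteq> {}" "linked (adj P) {z \<in> verts P. f z = i}"
      using linked_singleton by auto
  next
    fix i j :: nat assume "i < 2" "j < 2" "i \<noteq> j"
    then consider "i = 0" "j = 1" | "i = 1" "j = 0" by linarith
    moreover have "f x = 0" "f y = 1" using xy by (auto simp: f_def)
    ultimately show "\<exists>p\<in>verts P. \<exists>q\<in>verts P. f p = i \<and> f q = j \<and> adj P p q"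
      by cases (use xy a in blast)+
  qed
  then show ?thesis using le_hadwigerI[OF P] by blast
qed

text \<open>The sections with \<open>l\<close> edges of an infinite walk \<open>x\<close> are moved along it one edge at a time. Any
\<open>l + 1\<close> consecutive vertices are distinct. So a section cannot agree with one that starts \<open>m \<le> l\<close>
steps later, because their first vertices differ; nor with the reversal of that one, because for
\<open>m < l\<close> the end vertices differ, and for \<open>m = l\<close> the vertices next to the common end.\<close>

lemma path_graph_triangle_minor:
  assumes g: "graph G" and F: "F \<subseteq> edges G" "F \<noteq> {}" "leafless G F"
    and girth: "girth G \<ge> enat (Suc l)" and l: "l \<ge> 2"
  shows "3 \<le> hadwiger (path_graph l G)"
proof -
  have l0: "l > 0" using l by simp
  have "\<exists>d'. d' \<in> darts G F \<and> follows d d'" if d: "d \<in> darts G F" for d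
  proof -
    obtain x e y where xy: "d = (x, e, y)" "e \<in> F" "ends G e = {x, y}"
      using d by (auto simp: darts_def)
    then obtain f where f: "f \<in> F" "f \<noteq> e" "y \<in> ends G f"
      using F(3) unfolding leafless_def by blast
    then have "f \<in> edges G" using F(1) by blast
    then obtain z where "ends G f = {y, z}" using f(3) by (rule graph_other_endE[OF g])
    then show ?thesis using f xy by (intro exI[of _ "(y, f, z)"]) (auto simp: darts_def follows_def)
  qed
  then obtain nxt where nxt: "\<And>d. d \<in> darts G F \<Longrightarrow> nxt d \<in> darts G F \<and> follows d (nxt d)"
    by metis
  obtain e where e: "e \<in> F" using F(2) by blast
  then have "e \<in> edges G" using F(1) by blast
  then obtain x0 y0 where "ends G e = {x0, y0}" by (rule graph_endsE[OF g])
  then have d0: "(x0, e, y0) \<in> darts G F" using e by (simp add: darts_def)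
  define x where "x i = (nxt ^^ i) (x0, e, y0)" for i
  have x: "x i \<in> darts G F" for i
    by (induction i) (use d0 nxt in \<open>auto simp: x_def\<close>)
  then have step: "follows (x i) (x (Suc i))" for i using nxt by (simp add: x_def)
  define v where "v i = fst (x i)" for i
  have head: "snd (snd (x i)) = v (Suc i)" for i using step[of i] by (simp add: follows_def v_def)
  have walk: "map x [i..<i + n] \<in> dart_walks.walks G F n" for i n
    using x step unfolding dart_walks.walks_def by (auto simp: successively_conv_nth)
  define W where "W i = map x [i..<i + l]" for i
  have W: "W i \<in> dart_walks.walks G F l" for i using walk by (simp add: W_def)
  have vs: "fst (arc_of (W i)) = map v [i..<Suc (i + l)]" for i
  proof -
    have "hd (W i) = x i" using l0 by (simp add: W_def hd_map)
    moreover have "map (snd \<circ> snd) (W i) = map v [Suc i..<Suc (i + l)]"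
      by (simp add: W_def head comp_def flip: map_Suc_upt del: upt_Suc)
    moreover have "[i..<Suc (i + l)] = i # [Suc i..<Suc (i + l)]"
      by (rule upt_conv_Cons) simp
    ultimately show ?thesis by (simp only: arc_of_def fst_conv v_def list.map)
  qed
  have v_neq: "v i \<noteq> v j" if "i < j" "j \<le> i + l" for i j
  proof -
    have "distinct (map v [i..<Suc (i + l)])"
      using walk_distinct[OF g F(1) girth l0 W[of i]] vs by simp
    then have "inj_on v {i..<Suc (i + l)}" by (simp add: distinct_map del: upt_Suc)
    then show ?thesis using that by (auto dest: inj_onD)
  qed
  have neq: "link_of_walk (W i) \<noteq> link_of_walk (W (i + m))" if m: "1 \<le> m" "m \<le> l" for i m
  proof
    assume "link_of_walk (W i) = link_of_walk (W (i + m))"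
    then have "map v [i + m..<Suc (i + m + l)] = map v [i..<Suc (i + l)] \<or>
        map v [i + m..<Suc (i + m + l)] = rev (map v [i..<Suc (i + l)])"
      unfolding link_of_walk_def link_of_eq_iff using vs by (metis fst_conv)
    then have "v (i + m) = v i \<or> (\<forall>j\<le>l. v (i + m + j) = v (i + l - j))"
    proof
      assume eq: "map v [i + m..<Suc (i + m + l)] = map v [i..<Suc (i + l)]"
      have "map v [i + m..<Suc (i + m + l)] ! 0 = v (i + m)" "map v [i..<Suc (i + l)] ! 0 = v i"
        by (simp_all del: upt_Suc)
      then show ?thesis using eq by simp
    next
      assume eq: "map v [i + m..<Suc (i + m + l)] = rev (map v [i..<Suc (i + l)])"
      have "v (i + m + j) = v (i + l - j)" if "j \<le> l" for j
      proof -
        have "map v [i + m..<Suc (i + m + l)] ! j = v (i + m + j)"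
          using that by (simp del: upt_Suc)
        moreover have "rev (map v [i..<Suc (i + l)]) ! j = v (i + l - j)"
          using that by (simp add: rev_nth del: upt_Suc)
        ultimately show ?thesis using eq by simp
      qed
      then show ?thesis by blast
    qed
    then show False
    proof
      assume "v (i + m) = v i"
      then show False using v_neq[of i "i + m"] m by simp
    next
      assume *: "\<forall>j\<le>l. v (i + m + j) = v (i + l - j)"
      show False
      proof (cases "m = l")
        case True
        \<comment> \<open>Both sections contain vertex \<open>i + l\<close>; its two neighbours on the walk would coincide.\<close>
        then have "v (i + l + 1) = v (i + l - 1)" using *[rule_format, of 1] l by simp
        moreover have "i + l - 1 < i + l + 1" "i + l + 1 \<le> i + l - 1 + l" using l by linarith+
        ultimately show False using v_neq by metis
      next
        case False
        then show False using *[rule_format, of 0] v_neq[of "i + m" "i + l"] m by simp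
      qed
    qed
  qed
  show ?thesis
  proof (rule triangle_minor_of_walk[OF graph_path_graph[OF g]])
    fix i
    let ?Q = "map x [i..<i + Suc l]"
    have "butlast ?Q = W i" by (simp add: W_def butlast_append)
    moreover have "tl ?Q = W (Suc i)"
      by (simp add: W_def upt_conv_Cons del: upt_Suc)
    ultimately show "adj (path_graph l G) (link_of_walk (W i)) (link_of_walk (W (Suc i)))"
      using path_graph_adj[OF g F(1) girth l0 walk[of i "Suc l"]] neq[of 1 i] l0 by simp
    show "link_of_walk (W i) \<noteq> link_of_walk (W (Suc (Suc i)))"
      using neq[of 2 i] l by simp
  qed
qed

section \<open>The Hadwiger number of a path graph\<close>

lemma hadwiger_le_hadwiger_path_graph:
  assumes g: "graph G" and girth: "girth G \<ge> enat (Suc l)" and l: "l > 0"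
    and edge: "edges (path_graph l G) \<noteq> {}"
  shows "hadwiger G \<le> hadwiger (path_graph l G)"
proof -
  define t where "t = hadwiger G"
  obtain f where f: "clique_colouring (adj G) (verts G) t f"
    using hadwiger_clique_colouring[OF g] unfolding t_def .
  have two: "2 \<le> hadwiger (path_graph l G)"
    using edge_minor[OF graph_path_graph[OF g] edge] .
  consider "t \<le> 2" | "t = 3" "l = 1" | "t = 3" "l \<ge> 2" | "t \<ge> 4" using l by linarith
  then have "t \<le> hadwiger (path_graph l G)"
  proof cases
    case 2
    define H where "H = induced G {x \<in> verts G. f x < t}"
    have H: "subgraph H G" unfolding H_def by (rule subgraph_induced[OF g]) blast
    obtain f' where "clique_colouring (adj H) (verts H) t f'" "\<forall>x\<in>verts H. f' x < t"
      using clique_colouring_induced[OF f] by (auto simp: H_def induced_def)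
    then obtain c where "clique_colouring (meets H) (edges H) t c"
      using edge_colouring_of_vertex_colouring[of H t f'] H 2 by (auto simp: subgraph_def)
    then have "clique_colouring (meets G) (edges H) t c"
      by (rule clique_colouring_mono) (simp add: meets_def H_def induced_def)
    then show ?thesis
      using line_graph_minor[OF g, of "edges H"] H girth 2 by (simp add: subgraph_def)
  next
    case 3
    then show ?thesis
      using leafless_edge_set[OF g f] path_graph_triangle_minor[OF g _ _ _ girth] by auto
  next
    case 4
    then obtain F c where "F \<subseteq> edges G" "continuable G F c" "clique_colouring (meets G) F t c"
      using continuable_edge_colouring[OF g f] by blast
    then show ?thesis using path_graph_minor_of_continuable[OF g _ girth l] by blast
  qed (use two in simp)
  then show ?thesis by (simp add: t_def)
qed

lemma min_degree_le:
  assumes "graph H" "v \<in> verts H"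
  shows "min_degree H \<le> degree H v"
  using assms by (simp add: min_degree_def graph_def)

lemma degeneracy_subgraph:
  assumes g: "graph G" and "verts G \<noteq> {}"
  obtains H where "subgraph H G" "verts H \<noteq> {}" "min_degree H = degeneracy G"
proof -
  let ?D = "{min_degree H | H. subgraph H G \<and> verts H \<noteq> {}}"
  have "min_degree H \<le> card (edges G)" if H: "subgraph H G" "verts H \<noteq> {}" for H
  proof -
    obtain v where v: "v \<in> verts H" using H by blast
    have "min_degree H \<le> degree H v" using min_degree_le[OF _ v] H(1) by (simp add: subgraph_def)
    also have "\<dots> \<le> card (edges G)"
      unfolding degree_def using H g by (intro card_mono) (auto simp: subgraph_def graph_def)
    finally show ?thesis .
  qed
  then have "?D \<subseteq> {..card (edges G)}" by auto
  then have "finite ?D" by (rule finite_subset) simp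
  moreover have "subgraph G G" using g by (simp add: subgraph_def)
  then have "?D \<noteq> {}" using assms(2) by blast
  ultimately have "degeneracy G \<in> ?D" unfolding degeneracy_def by (rule Max_in)
  then obtain H where "degeneracy G = min_degree H" "subgraph H G" "verts H \<noteq> {}" by blast
  then show ?thesis using that[of H] by simp
qed

lemma degeneracy_le_hadwiger_path_graph:
  assumes g: "graph G" and girth: "girth G \<ge> enat (Suc l)" and l: "l > 0"
    and edge: "edges (path_graph l G) \<noteq> {}"
  shows "degeneracy G \<le> hadwiger (path_graph l G)"
proof (cases "degeneracy G \<le> 2")
  case True
  then show ?thesis using edge_minor[OF graph_path_graph[OF g] edge] by simp
next
  case False
  have "paths G l \<noteq> {}" using edge by (auto simp: path_graph_def)
  then have "verts G \<noteq> {}" by (auto simp: paths_def is_arc_def)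
  then obtain H where H: "subgraph H G" "verts H \<noteq> {}" "min_degree H = degeneracy G"
    using degeneracy_subgraph[OF g] by blast
  have gH: "graph H" using H(1) by (simp add: subgraph_def)
  have deg: "degeneracy G \<le> degree H x" if "x \<in> verts H" for x
    using min_degree_le[OF gH that] H(3) by simp
  obtain v where "v \<in> verts H" using H(2) by blast
  then obtain c where c: "clique_colouring (meets H) (edges H) (degeneracy G) c"
    using star_edge_colouring[OF gH deg] by blast
  have "continuable H (edges H) c"
    using continuable_of_degree[OF gH] deg False by fastforce
  moreover have ends: "\<forall>e\<in>edges H. ends H e = ends G e" "edges H \<subseteq> edges G"
    using H(1) by (auto simp: subgraph_def)
  ultimately have "continuable G (edges H) c" by (simp add: continuable_def)
  moreover have "clique_colouring (meets G) (edges H) (degeneracy G) c"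
    by (rule clique_colouring_mono[OF c]) (use ends in \<open>simp add: meets_def\<close>)
  ultimately show ?thesis
    using path_graph_minor_of_continuable[OF g ends(2) girth l] by blast
qed

theorem corollary1p4:
  fixes G :: "('v, 'e) mgraph" and l :: nat
  assumes "l \<ge> 1"
    and "graph G"
    and "girth G \<ge> enat (l + 1)"
    and "edges (path_graph l G) \<noteq> {}"
  shows "hadwiger (path_graph l G) \<ge> max (hadwiger G) (degeneracy G)"
  using hadwiger_le_hadwiger_path_graph[of G l] degeneracy_le_hadwiger_path_graph[of G l] assms
  by simp

end
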